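(* Let $T$ be a tree with closed neighborhood ideal $NI(T)$ in the polynomial ring $R$. Then the projective dimension satisfies $$\mathrm{pd}(R/NI(T))=\alpha(T),$$ where $\alpha(T)$ denotes the independence number of $T$.
   Context: All graphs are finite and simple; a tree is a connected graph with no cycles. Let $T$ have vertex set $\{x_1,\dots,x_n\}$ and let $R=\mathbb{K}[x_1,\dots,x_n]$ with $\mathbb{K}$ a field. For a vertex $v$, $N_T[v]$ is the set consisting of $v$ and its neighbors, and $m(T,v)=\prod_{y\in N_T[v]}y$. The closed neighborhood ideal is $NI(T)=\langle m(T,v):v\in V(T)\rangle\subseteq R$. The projective dimension $\mathrm{pd}(R/I)$ is the length of a minimal graded free resolution of $R/I$ over $R$. The independence number $\alpha(T)$ is the maximum cardinality of a set of pairwise non-adjacent vertices of $T$. *)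

theory Defs
  imports
    "HOL-Library.Poly_Mapping"
    "HOL-Library.Extended_Nat"
    "Jordan_Normal_Form.Matrix"
begin

section \<open>Graphs\<close>

text \<open>The vertex set of a graph is a whole type, which is finite in the class
  \<^class>\<open>finite\<close>, and its edges are given by an adjacency relation.\<close>

definition simple_graph :: "('v \<Rightarrow> 'v \<Rightarrow> bool) \<Rightarrow> bool" where
  "simple_graph E \<longleftrightarrow> (\<forall>u v. E u v \<longrightarrow> E v u) \<and> (\<forall>v. \<not> E v v)"

definition connected_graph :: "('v \<Rightarrow> 'v \<Rightarrow> bool) \<Rightarrow> bool" where
  "connected_graph E \<longleftrightarrow> (\<forall>u v. E\<^sup>*\<^sup>* u v)"

definition is_cycle :: "('v \<Rightarrow> 'v \<Rightarrow> bool) \<Rightarrow> 'v list \<Rightarrow> bool" where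
  "is_cycle E c \<longleftrightarrow> length c \<ge> 3 \<and> distinct c \<and>
     (\<forall>i < length c. E (c ! i) (c ! (Suc i mod length c)))"

definition is_tree :: "('v \<Rightarrow> 'v \<Rightarrow> bool) \<Rightarrow> bool" where
  "is_tree E \<longleftrightarrow> simple_graph E \<and> connected_graph E \<and> (\<nexists>c. is_cycle E c)"

definition closed_neighborhood :: "('v \<Rightarrow> 'v \<Rightarrow> bool) \<Rightarrow> 'v \<Rightarrow> 'v set" where
  "closed_neighborhood E v = insert v {u. E v u}"

definition independent_set :: "('v \<Rightarrow> 'v \<Rightarrow> bool) \<Rightarrow> 'v set \<Rightarrow> bool" where
  "independent_set E S \<longleftrightarrow> (\<forall>u\<in>S. \<forall>v\<in>S. \<not> E u v)"

definition independence_number :: "('v::finite \<Rightarrow> 'v \<Rightarrow> bool) \<Rightarrow> nat" where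
  "independence_number E = Max (card ` {S. independent_set E S})"


section \<open>The polynomial ring with one variable per vertex\<close>

text \<open>A monomial is an exponent vector, and multiplication on
  \<^typ>\<open>('v \<Rightarrow>\<^sub>0 nat) \<Rightarrow>\<^sub>0 'k::comm_ring_1\<close> is convolution, so this type is the
  polynomial ring over \<open>'k\<close> in the variables indexed by \<open>'v\<close>.\<close>

type_synonym ('v, 'k) mpoly = "('v \<Rightarrow>\<^sub>0 nat) \<Rightarrow>\<^sub>0 'k"

definition var :: "'v \<Rightarrow> ('v, 'k::comm_ring_1) mpoly" where
  "var v = Poly_Mapping.single (Poly_Mapping.single v 1) 1"

definition monomial_degree :: "('v \<Rightarrow>\<^sub>0 nat) \<Rightarrow> nat" where
  "monomial_degree m = (\<Sum>v\<in>Poly_Mapping.keys m. Poly_Mapping.lookup m v)"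

text \<open>As usual, 0 is homogeneous of every degree. Degrees are integers because they arise
  as differences of twists.\<close>

definition homogeneous :: "int \<Rightarrow> ('v, 'k::comm_ring_1) mpoly \<Rightarrow> bool" where
  "homogeneous e p \<longleftrightarrow> (\<forall>m\<in>Poly_Mapping.keys p. int (monomial_degree m) = e)"

definition ideal_of :: "'a::comm_ring_1 set \<Rightarrow> 'a set" where
  "ideal_of S = Modules.module.span (*) S"

definition irrelevant_ideal :: "('v, 'k::comm_ring_1) mpoly set" where
  "irrelevant_ideal = ideal_of (range var)"


section \<open>Closed neighborhood ideals\<close>

definition closed_neighborhood_monomial ::
  "('v::finite \<Rightarrow> 'v \<Rightarrow> bool) \<Rightarrow> 'v \<Rightarrow> ('v, 'k::comm_ring_1) mpoly" where
  "closed_neighborhood_monomial E v = (\<Prod>y\<in>closed_neighborhood E v. var y)"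

definition closed_neighborhood_ideal ::
  "('v::finite \<Rightarrow> 'v \<Rightarrow> bool) \<Rightarrow> ('v, 'k::comm_ring_1) mpoly set" where
  "closed_neighborhood_ideal E = ideal_of (range (closed_neighborhood_monomial E))"


section \<open>Minimal graded free resolutions and projective dimension\<close>

text \<open>With \<open>F\<^sub>i = \<Oplus>\<^sub>j\<^sub><\<^sub>\<beta>\<^sub>i R(-d\<^sub>i\<^sub>j)\<close>, the following says that
  \<open>\<dots> \<rightarrow> F\<^sub>2 \<rightarrow> F\<^sub>1 \<rightarrow> F\<^sub>0 \<rightarrow> R/I \<rightarrow> 0\<close>
  is an exact complex of graded modules and maps of degree 0. The differential
  \<open>F\<^sub>i\<^sub>+\<^sub>1 \<rightarrow> F\<^sub>i\<close> is the matrix \<open>\<phi> (Suc i)\<close>. The augmentation \<open>F\<^sub>0 \<rightarrow> R/I\<close> is given by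
  the one-row matrix \<open>\<phi> 0\<close> followed by the quotient map: its entries are homogeneous
  representatives of the images of the basis elements, so an element of \<open>F\<^sub>0\<close> lies in its
  kernel iff the matrix sends it into \<open>I\<close>, and it is onto iff every element of \<open>R\<close> is
  congruent modulo \<open>I\<close> to a value of the matrix.\<close>

definition graded_free_resolution ::
  "('v, 'k::comm_ring_1) mpoly set \<Rightarrow> (nat \<Rightarrow> nat) \<Rightarrow> (nat \<Rightarrow> nat \<Rightarrow> int) \<Rightarrow>
   (nat \<Rightarrow> ('v, 'k) mpoly mat) \<Rightarrow> bool" where
  "graded_free_resolution I \<beta> d \<phi> \<longleftrightarrow>
     \<phi> 0 \<in> carrier_mat 1 (\<beta> 0) \<and>
     (\<forall>i. \<phi> (Suc i) \<in> carrier_mat (\<beta> i) (\<beta> (Suc i))) \<and>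
     (\<forall>j < \<beta> 0. homogeneous (d 0 j) (\<phi> 0 $$ (0, j))) \<and>
     (\<forall>i. \<forall>k < \<beta> i. \<forall>j < \<beta> (Suc i).
        homogeneous (d (Suc i) j - d i k) (\<phi> (Suc i) $$ (k, j))) \<and>
     (\<forall>p. \<exists>x \<in> carrier_vec (\<beta> 0). p - (\<phi> 0 *\<^sub>v x) $ 0 \<in> I) \<and>
     {x \<in> carrier_vec (\<beta> 0). (\<phi> 0 *\<^sub>v x) $ 0 \<in> I} =
       (\<lambda>y. \<phi> 1 *\<^sub>v y) ` carrier_vec (\<beta> 1) \<and>
     (\<forall>i. {x \<in> carrier_vec (\<beta> (Suc i)). \<phi> (Suc i) *\<^sub>v x = 0\<^sub>v (\<beta> i)} =
       (\<lambda>y. \<phi> (Suc (Suc i)) *\<^sub>v y) ` carrier_vec (\<beta> (Suc (Suc i))))"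

definition minimal_graded_free_resolution ::
  "('v, 'k::comm_ring_1) mpoly set \<Rightarrow> (nat \<Rightarrow> nat) \<Rightarrow> (nat \<Rightarrow> nat \<Rightarrow> int) \<Rightarrow>
   (nat \<Rightarrow> ('v, 'k) mpoly mat) \<Rightarrow> bool" where
  "minimal_graded_free_resolution I \<beta> d \<phi> \<longleftrightarrow>
     graded_free_resolution I \<beta> d \<phi> \<and>
     (\<forall>i. \<forall>k < \<beta> i. \<forall>j < \<beta> (Suc i). \<phi> (Suc i) $$ (k, j) \<in> irrelevant_ideal)"

definition resolution_length :: "(nat \<Rightarrow> nat) \<Rightarrow> enat" where
  "resolution_length \<beta> = (SUP i\<in>{i. \<beta> i \<noteq> 0}. enat i)"

text \<open>The projective dimension of \<open>R/I\<close> (not of \<open>I\<close>), for a homogeneous ideal \<open>I\<close>. It is well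
  defined because a minimal graded free resolution exists and is unique up to isomorphism.\<close>

definition pd_quotient :: "('v, 'k::field) mpoly set \<Rightarrow> enat" where
  "pd_quotient I =
     (THE l. \<exists>\<beta> d \<phi>. minimal_graded_free_resolution I \<beta> d \<phi> \<and> l = resolution_length \<beta>)"

end

theory Submission
  imports Defs
begin

text \<open>The closed neighborhoods of a tree, traced on any set \<open>W\<close> of vertices, have a free vertex: if the
  vertices are ranked by successive removal of leaves and \<open>x\<close> has least rank in \<open>W\<close>, then the traces
  containing \<open>x\<close> form a chain under inclusion. If there are none, \<open>x\<close> can be dropped from \<open>W\<close>. Otherwise
  let \<open>e\<close> be the smallest of them, and let \<open>I'\<close> be the ideal of the traces that avoid \<open>x\<close>. The ideal of all traces is \<open>I = I' + (x m)\<close> with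
  \<open>m\<close> the monomial of \<open>e - {x}\<close>, and there is an exact sequence
  \<open>0 \<rightarrow> R/(I' : m) \<rightarrow> R/I' \<rightarrow> R/I \<rightarrow> 0\<close>, whose first map is multiplication by \<open>x m\<close>. This map
  lifts to \<open>x\<close> times a chain map of minimal resolutions, so its mapping cone is again a minimal
  resolution (\<open>minimal_mapping_cone\<close>), and
  \<open>\<beta>\<^sub>i(R/I) = \<beta>\<^sub>i(R/I') + \<beta>\<^sub>i\<^sub>-\<^sub>1(R/(I' : m))\<close>. Both smaller ideals come from traces of closed
  neighborhoods on fewer vertices, so the argument can be iterated.

  The largest cardinality of a minimal transversal of the hypergraph obeys the same recursion, and
  therefore equals the length of the resolution if no edge is empty
  (\<open>decomposable_minimal_resolution\<close>). For the closed neighborhoods themselves, the minimal transversals are the minimal dominating sets. A largest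
  independent set is one of them, and since a tree is bipartite, no minimal dominating set is larger
  than a largest independent set.

  That the length does not depend on the minimal resolution follows from comparing two of
  them: the composites of the comparison maps are homotopic to the identity and hence equal to it
  modulo the irrelevant ideal (\<open>minimal_resolution_support_subset\<close>).\<close>

section \<open>Forests\<close>

lemma exists_leaf_in_subset:
  fixes E :: "'v \<Rightarrow> 'v \<Rightarrow> bool"
  assumes "simple_graph E" and acyclic: "\<nexists>c. is_cycle E c"
    and W: "finite W" "W \<noteq> {}"
  obtains u where "u \<in> W" "\<And>a b. a \<in> W \<Longrightarrow> b \<in> W \<Longrightarrow> E u a \<Longrightarrow> E u b \<Longrightarrow> a = b"
proof -
  have sym: "E v u" if "E u v" for u v using assms(1) that by (auto simp: simple_graph_def)
  have irrefl: "\<not> E v v" for v using assms(1) by (auto simp: simple_graph_def)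
  define path where "path p \<longleftrightarrow> p \<noteq> [] \<and> distinct p \<and> set p \<subseteq> W \<and>
    (\<forall>i. Suc i < length p \<longrightarrow> E (p ! i) (p ! Suc i))" for p
  obtain w where "w \<in> W" using W by blast
  then have "path [w]" by (auto simp: path_def)
  moreover have bound: "length p \<le> card W" if "path p" for p
    using that W(1) by (metis path_def card_mono distinct_card)
  ultimately obtain p where p: "path p" and max: "\<And>q. path q \<Longrightarrow> length q \<le> length p"
    using ex_has_greatest_nat[of path "[w]" length "Suc (card W)"] by (metis le_imp_less_Suc)
  have adj: "E (p ! i) (p ! Suc i)" if "Suc i < length p" for i
    using p that by (auto simp: path_def)
  have p_ne: "p \<noteq> []" and p_dist: "distinct p" and p_W: "set p \<subseteq> W"
    using p by (auto simp: path_def)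
  \<comment> \<open>By maximality every neighbour of the first vertex lies on the path.\<close>
  have nbr: "\<exists>k. 1 \<le> k \<and> k < length p \<and> p ! k = a" if "a \<in> W" "E (p ! 0) a" for a
  proof -
    have "a \<in> set p"
    proof (rule ccontr)
      assume "a \<notin> set p"
      then have "path (a # p)"
        using that sym p p_ne by (auto simp: path_def nth_Cons split: nat.split)
      then show False using max[of "a # p"] by simp
    qed
    then obtain k where "k < length p" "p ! k = a" by (auto simp: in_set_conv_nth)
    moreover from this have "k \<noteq> 0" using that irrefl by metis
    ultimately show ?thesis by (intro exI[of _ k]) auto
  qed
  have no_chord: False if "2 \<le> k" "k < length p" "E (p ! 0) (p ! k)" for k
  proof -
    have "is_cycle E (take (Suc k) p)"
      unfolding is_cycle_def
    proof (intro conjI allI impI)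
      fix i assume i: "i < length (take (Suc k) p)"
      show "E (take (Suc k) p ! i) (take (Suc k) p ! (Suc i mod length (take (Suc k) p)))"
      proof (cases "i = k")
        case True
        then show ?thesis using that sym by simp
      next
        case False
        then have "i < k" using i by simp
        then show ?thesis using that adj[of i] by simp
      qed
    qed (use that p_dist in auto)
    then show False using acyclic by blast
  qed
  show thesis
  proof
    show "p ! 0 \<in> W" using p_ne p_W by (meson length_greater_0_conv nth_mem subsetD)
  next
    fix a b assume "a \<in> W" "b \<in> W" "E (p ! 0) a" "E (p ! 0) b"
    have "c = p ! 1" if c: "c \<in> W" "E (p ! 0) c" for c
    proof -
      obtain k where "1 \<le> k" "k < length p" "p ! k = c" using nbr[OF c] by blast
      moreover have "\<not> 2 \<le> k" using no_chord c calculation by blast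
      ultimately have "k = 1" by linarith
      then show ?thesis using \<open>p ! k = c\<close> by simp
    qed
    then show "a = b" using \<open>a \<in> W\<close> \<open>b \<in> W\<close> \<open>E (p ! 0) a\<close> \<open>E (p ! 0) b\<close> by metis
  qed
qed

text \<open>Repeatedly removing a vertex with at most one remaining neighbour ranks the vertices by the
  time of their removal. Each edge then joins a vertex \<open>u\<close> to its parent \<open>par u\<close>, which is removed
  later, and a proper 2-colouring is obtained by reinserting the vertices in reverse order.\<close>

lemma acyclic_elimination:
  fixes E :: "'v \<Rightarrow> 'v \<Rightarrow> bool"
  assumes "simple_graph E" "\<nexists>c. is_cycle E c" "finite W"
  shows "\<exists>(rank :: 'v \<Rightarrow> nat) par (colour :: 'v \<Rightarrow> bool). \<forall>u\<in>W. \<forall>v\<in>W. E u v \<longrightarrow>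
    colour u \<noteq> colour v \<and> (rank u < rank v \<and> v = par u \<or> rank v < rank u \<and> u = par v)"
  using assms(3)
proof (induction "card W" arbitrary: W)
  case 0
  then show ?case by simp
next
  case (Suc n)
  have sym: "E v u" if "E u v" for u v using assms(1) that by (auto simp: simple_graph_def)
  have irrefl: "\<not> E v v" for v using assms(1) by (auto simp: simple_graph_def)
  have "W \<noteq> {}" using Suc.hyps(2) by auto
  with exists_leaf_in_subset[OF assms(1,2) \<open>finite W\<close>] obtain l where
    l: "l \<in> W" "\<And>a b. a \<in> W \<Longrightarrow> b \<in> W \<Longrightarrow> E l a \<Longrightarrow> E l b \<Longrightarrow> a = b" by metis
  have "n = card (W - {l})" using Suc.hyps(2) l(1) Suc.prems by simp
  from Suc.hyps(1)[OF this] Suc.prems obtain rank :: "'v \<Rightarrow> nat" and par and colour :: "'v \<Rightarrow> bool"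
    where IH: "\<And>u v. u \<in> W - {l} \<Longrightarrow> v \<in> W - {l} \<Longrightarrow> E u v \<Longrightarrow>
      colour u \<noteq> colour v \<and> (rank u < rank v \<and> v = par u \<or> rank v < rank u \<and> u = par v)"
    by (metis finite_Diff)
  define q where "q = (SOME a. a \<in> W \<and> E l a)"
  have q: "a = q" if "a \<in> W" "E l a" for a
    using that l(2) someI[of "\<lambda>a. a \<in> W \<and> E l a"] unfolding q_def by metis
  let ?rank = "(Suc \<circ> rank)(l := 0)" and ?par = "par(l := q)"
    and ?colour = "colour(l := \<not> colour q)"
  show ?case
  proof (rule exI[of _ ?rank], rule exI[of _ ?par], rule exI[of _ ?colour], intro ballI impI)
    fix u v assume uv: "u \<in> W" "v \<in> W" "E u v"
    have ne: "u \<noteq> v" using uv irrefl by auto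
    consider "u = l" | "v = l" | "u \<noteq> l" "v \<noteq> l" by blast
    then show "?colour u \<noteq> ?colour v \<and>
      (?rank u < ?rank v \<and> v = ?par u \<or> ?rank v < ?rank u \<and> u = ?par v)"
    proof cases
      case 1
      then have "v = q" using q[of v] uv by simp
      then show ?thesis using 1 ne by simp
    next
      case 2
      then have "u = q" using q[of u] uv sym[of u v] by simp
      then show ?thesis using 2 ne by simp
    next
      case 3
      then show ?thesis using IH[of u v] uv by simp
    qed
  qed
qed

section \<open>Transversals and free vertices of hypergraphs\<close>

text \<open>A transversal meets every edge. It is minimal under inclusion iff each of its elements is the only
  one in some edge, and this is taken as the definition.\<close>

definition minimal_transversal :: "'v set set \<Rightarrow> 'v set \<Rightarrow> bool" where
  "minimal_transversal H S \<longleftrightarrow> (\<forall>e\<in>H. e \<inter> S \<noteq> {}) \<and> (\<forall>s\<in>S. \<exists>e\<in>H. e \<inter> S = {s})"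

text \<open>The hypergraphs that can be taken apart completely at vertices \<open>x\<close> whose edges have a
  smallest member \<open>e\<close>: both the deletion of all edges through \<open>x\<close> and the subsequent deletion of
  the vertices of \<open>e\<close> have to yield decomposable hypergraphs again. The process ends when no edge is
  left or when some edge is empty.\<close>

inductive decomposable :: "'v set set \<Rightarrow> bool" where
  no_edges: "decomposable {}"
| empty_edge: "{} \<in> H \<Longrightarrow> decomposable H"
| free_vertex: "\<lbrakk>e \<in> H; x \<in> e; \<And>f. f \<in> H \<Longrightarrow> x \<in> f \<Longrightarrow> e \<subseteq> f;
    decomposable {f \<in> H. x \<notin> f}; decomposable ((\<lambda>f. f - e) ` {f \<in> H. x \<notin> f})\<rbrakk>
   \<Longrightarrow> decomposable H"

lemma minimal_transversal_hits: "minimal_transversal H S \<Longrightarrow> e \<in> H \<Longrightarrow> e \<inter> S \<noteq> {}"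
  and minimal_transversal_private: "minimal_transversal H S \<Longrightarrow> s \<in> S \<Longrightarrow> \<exists>e\<in>H. e \<inter> S = {s}"
  and minimal_transversalI: "(\<And>e. e \<in> H \<Longrightarrow> e \<inter> S \<noteq> {}) \<Longrightarrow>
    (\<And>s. s \<in> S \<Longrightarrow> \<exists>e\<in>H. e \<inter> S = {s}) \<Longrightarrow> minimal_transversal H S"
  by (simp_all add: minimal_transversal_def)

lemma minimal_transversal_extend_link:
  assumes e: "e \<in> H" "x \<in> e"
    and S: "minimal_transversal ((\<lambda>f. f - e) ` {f \<in> H. x \<notin> f}) S"
  shows "minimal_transversal H (insert x S)" "x \<notin> S"
proof -
  have priv: "\<exists>f. f \<in> H \<and> x \<notin> f \<and> (f - e) \<inter> S = {s}" if "s \<in> S" for s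
    using minimal_transversal_private[OF S that] by auto
  have disj: "S \<inter> e = {}" using priv by blast
  then show x: "x \<notin> S" using e by auto
  show "minimal_transversal H (insert x S)"
  proof (rule minimal_transversalI)
    fix f assume "f \<in> H"
    then show "f \<inter> insert x S \<noteq> {}"
      using minimal_transversal_hits[OF S, of "f - e"] by (cases "x \<in> f") auto
  next
    fix s assume "s \<in> insert x S"
    then consider "s = x" | "s \<in> S" by blast
    then show "\<exists>f\<in>H. f \<inter> insert x S = {s}"
    proof cases
      case 1
      then have "e \<inter> insert x S = {s}" using disj e by auto
      then show ?thesis using e by metis
    next
      case 2
      with priv obtain f where f: "f \<in> H" "x \<notin> f" "(f - e) \<inter> S = {s}" by metis
      then have "f \<inter> insert x S = {s}" using disj by blast
      then show ?thesis using f by metis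
    qed
  qed
qed

lemma minimal_transversal_extend_deletion:
  assumes e: "e \<in> H" "x \<in> e" "\<And>f. f \<in> H \<Longrightarrow> x \<in> f \<Longrightarrow> e \<subseteq> f"
    and S: "minimal_transversal {f \<in> H. x \<notin> f} S"
  shows "minimal_transversal H S \<or> (minimal_transversal H (insert x S) \<and> x \<notin> S)"
proof -
  have priv: "\<exists>f. f \<in> H \<and> x \<notin> f \<and> f \<inter> S = {s}" if "s \<in> S" for s
    using minimal_transversal_private[OF S that] by auto
  show ?thesis
  proof (cases "e \<inter> S = {}")
    case False
    have "f \<inter> S \<noteq> {}" if "f \<in> H" for f
      using minimal_transversal_hits[OF S, of f] that e(3)[OF that] False
      by (cases "x \<in> f") blast+
    then have "minimal_transversal H S"
      using priv by (intro minimal_transversalI) blast+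
    then show ?thesis ..
  next
    case True
    have x: "x \<notin> S" using priv by blast
    have "minimal_transversal H (insert x S)"
    proof (rule minimal_transversalI)
      fix f assume "f \<in> H"
      then show "f \<inter> insert x S \<noteq> {}"
        using minimal_transversal_hits[OF S, of f] by (cases "x \<in> f") auto
    next
      fix s assume "s \<in> insert x S"
      then consider "s = x" | "s \<in> S" by blast
      then show "\<exists>f\<in>H. f \<inter> insert x S = {s}"
      proof cases
        case 1
        then have "e \<inter> insert x S = {s}" using True e by auto
        then show ?thesis using e by metis
      next
        case 2
        with priv obtain f where f: "f \<in> H" "x \<notin> f" "f \<inter> S = {s}" by metis
        then have "f \<inter> insert x S = {s}" by blast
        then show ?thesis using f by metis
      qed
    qed
    then show ?thesis using x by blast
  qed
qed

text \<open>If \<open>S\<close> is not minimal for the edges avoiding \<open>x\<close>, then some \<open>s\<close> is needed only for edges through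
  \<open>x\<close>. It is then the only element of \<open>S\<close> in \<open>e\<close>.\<close>

lemma minimal_transversal_restrict:
  assumes e: "e \<in> H" "x \<in> e" "\<And>f. f \<in> H \<Longrightarrow> x \<in> f \<Longrightarrow> e \<subseteq> f"
    and S: "minimal_transversal H S"
  shows "minimal_transversal {f \<in> H. x \<notin> f} S \<or>
    (\<exists>s\<in>S. minimal_transversal ((\<lambda>f. f - e) ` {f \<in> H. x \<notin> f}) (S - {s}))"
proof (cases "\<forall>s\<in>S. \<exists>f\<in>H. x \<notin> f \<and> f \<inter> S = {s}")
  case True
  then have "minimal_transversal {f \<in> H. x \<notin> f} S"
    using minimal_transversal_hits[OF S] by (intro minimal_transversalI) (simp_all add: Bex_def conj_assoc)
  then show ?thesis ..
next
  case False
  then obtain s where s: "s \<in> S" and no: "\<And>f. f \<in> H \<Longrightarrow> x \<notin> f \<Longrightarrow> f \<inter> S \<noteq> {s}" by metis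
  obtain g where g: "g \<in> H" "g \<inter> S = {s}" using minimal_transversal_private[OF S s] by metis
  have "x \<in> g" using no g by metis
  then have "e \<subseteq> g" using e(3) g(1) by metis
  moreover have "e \<inter> S \<noteq> {}" using minimal_transversal_hits[OF S e(1)] .
  ultimately have eS: "e \<inter> S = {s}" using g(2) by auto
  have "minimal_transversal ((\<lambda>f. f - e) ` {f \<in> H. x \<notin> f}) (S - {s})"
  proof (rule minimal_transversalI)
    fix f' assume "f' \<in> (\<lambda>f. f - e) ` {f \<in> H. x \<notin> f}"
    then obtain f where f: "f \<in> H" "x \<notin> f" "f' = f - e" by auto
    obtain t where t: "t \<in> f" "t \<in> S" "t \<noteq> s"
      using no[OF f(1,2)] minimal_transversal_hits[OF S f(1)] by (metis IntE equals0I singletonI subset_singletonD subsetI)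
    then have "t \<notin> e" using eS by blast
    then show "f' \<inter> (S - {s}) \<noteq> {}" using t f(3) by auto
  next
    fix t assume t: "t \<in> S - {s}"
    then obtain f where f: "f \<in> H" "f \<inter> S = {t}" using minimal_transversal_private[OF S, of t] by auto
    have "x \<notin> f"
    proof
      assume "x \<in> f"
      then have "e \<subseteq> f" using e(3) f(1) by metis
      moreover have "s \<in> e" "s \<in> S" using eS by auto
      ultimately have "s \<in> f \<inter> S" by auto
      then show False using f(2) t by auto
    qed
    moreover have "(f - e) \<inter> (S - {s}) = {t}"
    proof -
      have "t \<in> f" "t \<notin> e" using f(2) t eS by auto
      then show ?thesis using f(2) t by auto
    qed
    ultimately show "\<exists>f'\<in>(\<lambda>f. f - e) ` {f \<in> H. x \<notin> f}. f' \<inter> (S - {s}) = {t}"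
      using f(1) by auto
  qed
  then show ?thesis using s by blast
qed

section \<open>Closed neighborhoods in forests\<close>

text \<open>The traces on \<open>W\<close> of closed neighborhoods in a forest form a decomposable hypergraph. A vertex
  \<open>x\<close> of least rank in \<open>W\<close> is free. No child of \<open>x\<close> lies in \<open>W\<close>, so the trace of the closed
  neighborhood of \<open>x\<close> is contained in \<open>{x, par x}\<close>, and that of a child is \<open>{x}\<close>. These are both
  contained in the trace of the closed neighborhood of the parent.\<close>

lemma closed_neighborhood_traces_decomposable:
  fixes E :: "'v \<Rightarrow> 'v \<Rightarrow> bool"
  assumes sym: "\<And>u v. E u v \<Longrightarrow> E v u"
    and rank: "\<And>u v. E u v \<Longrightarrow>
      (rank u :: nat) < rank v \<and> v = par u \<or> rank v < rank u \<and> u = par v"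
    and "finite W"
  shows "decomposable ((\<lambda>v. closed_neighborhood E v \<inter> W) ` U)"
  using \<open>finite W\<close>
proof (induction "card W" arbitrary: W U rule: less_induct)
  case less
  let ?N = "closed_neighborhood E"
  show ?case
  proof (cases "\<exists>x\<in>W. \<forall>v\<in>U. x \<notin> ?N v")
    case True
    then obtain x where x: "x \<in> W" "\<forall>v\<in>U. x \<notin> ?N v" by blast
    then have "decomposable ((\<lambda>v. ?N v \<inter> (W - {x})) ` U)"
      using less.hyps[of "W - {x}"] less.prems by (metis card_Diff1_less finite_Diff)
    moreover have "(\<lambda>v. ?N v \<inter> (W - {x})) ` U = (\<lambda>v. ?N v \<inter> W) ` U"
      using x by (intro image_cong) auto
    ultimately show ?thesis by simp
  next
    case False
    then have cov: "\<And>w. w \<in> W \<Longrightarrow> \<exists>v\<in>U. w \<in> ?N v" by blast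
    show ?thesis
    proof (cases "W = {}")
      case True
      then show ?thesis
        by (cases "U = {}") (auto simp: decomposable.no_edges intro: decomposable.empty_edge)
    next
      case False
      then obtain w0 where "w0 \<in> W" by blast
      then have "\<exists>x. x \<in> W \<and> (\<forall>w. w \<in> W \<longrightarrow> rank x \<le> rank w)"
        by (rule ex_has_least_nat)
      then obtain x where x: "x \<in> W" and least: "\<And>w. w \<in> W \<Longrightarrow> rank x \<le> rank w" by blast
      let ?H = "(\<lambda>v. ?N v \<inter> W) ` U"
      let ?U = "{v \<in> U. x \<notin> ?N v}"
      have nbr: "w = par v" if "w \<in> W" "E v w" "rank v \<le> rank x" for v w
        using rank[OF that(2)] least[OF that(1)] that(3) by auto
      have chain: "?N v \<inter> W \<subseteq> ?N w \<inter> W \<or> ?N w \<inter> W \<subseteq> ?N v \<inter> W" if "x \<in> ?N v" "x \<in> ?N w" for v w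
      proof -
        have low: "?N c \<inter> W = {x}" if "x \<in> ?N c" "c \<noteq> x" "c \<noteq> par x" for c
        proof -
          have "E c x" using that by (auto simp: closed_neighborhood_def)
          then have "rank c < rank x" "x = par c" using rank[OF \<open>E c x\<close>] that by auto
          have "w = x" if "w \<in> ?N c" "w \<in> W" for w
          proof (cases "w = c")
            case True
            then show ?thesis using least[OF that(2)] \<open>rank c < rank x\<close> by simp
          next
            case False
            then have "E c w" using that by (simp add: closed_neighborhood_def)
            then show ?thesis using nbr[OF that(2) \<open>E c w\<close>] \<open>rank c < rank x\<close> \<open>x = par c\<close> by simp
          qed
          then show ?thesis using that(1) x by blast
        qed
        have own: "?N x \<inter> W \<subseteq> {x, par x}" "x \<in> ?N x \<inter> W"
          using nbr[where v = x] x by (fastforce simp: closed_neighborhood_def)+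
        have parent: "?N x \<inter> W \<subseteq> ?N (par x) \<inter> W" if "x \<in> ?N (par x)"
          using own that x by (auto simp: closed_neighborhood_def)
        have "?N u \<inter> W = {x} \<or> u = x \<or> u = par x" if "x \<in> ?N u" for u
          using low[OF that] by blast
        then consider "?N v \<inter> W = {x}" | "?N w \<inter> W = {x}" | "v = w"
          | "v = x" "w = par x" | "v = par x" "w = x"
          using \<open>x \<in> ?N v\<close> \<open>x \<in> ?N w\<close> by metis
        then show ?thesis
        proof cases
          case 1
          then show ?thesis using \<open>x \<in> ?N w\<close> x by simp
        next
          case 2
          then show ?thesis using \<open>x \<in> ?N v\<close> x by simp
        next
          case 4
          then show ?thesis using parent \<open>x \<in> ?N w\<close> by simp
        next
          case 5
          then show ?thesis using parent \<open>x \<in> ?N v\<close> by simp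
        qed simp
      qed
      obtain v where v: "v \<in> U" "x \<in> ?N v" and smallest: "\<And>w. w \<in> U \<Longrightarrow> x \<in> ?N w \<Longrightarrow> ?N v \<inter> W \<subseteq> ?N w \<inter> W"
      proof -
        define P where "P v \<longleftrightarrow> v \<in> U \<and> x \<in> ?N v" for v
        obtain v0 where "P v0" using cov[OF x] by (auto simp: P_def)
        then have "\<exists>v. P v \<and> (\<forall>w. P w \<longrightarrow> card (?N v \<inter> W) \<le> card (?N w \<inter> W))"
          by (rule ex_has_least_nat)
        then obtain v where v: "P v" "\<And>w. P w \<Longrightarrow> card (?N v \<inter> W) \<le> card (?N w \<inter> W)"
          by blast
        have "?N v \<inter> W \<subseteq> ?N w \<inter> W" if "P w" for w
        proof (rule ccontr)
          assume "\<not> ?thesis"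
          then have "?N w \<inter> W \<subset> ?N v \<inter> W" using chain[of v w] v(1) that by (auto simp: P_def)
          then have "card (?N w \<inter> W) < card (?N v \<inter> W)" using less.prems by (simp add: psubset_card_mono)
          then show False using v(2)[OF that] by simp
        qed
        then show thesis using that v(1) by (auto simp: P_def)
      qed
      have del: "{f \<in> ?H. x \<notin> f} = (\<lambda>v. ?N v \<inter> W) ` ?U" using x by auto
      have del': "\<dots> = (\<lambda>v. ?N v \<inter> (W - {x})) ` ?U" by (intro image_cong) auto
      have link: "(\<lambda>f. f - (?N v \<inter> W)) ` {f \<in> ?H. x \<notin> f} = (\<lambda>w. ?N w \<inter> (W - ?N v)) ` ?U"
        unfolding del image_image by (intro image_cong) auto
      have "card (W - {x}) < card W" "card (W - ?N v) < card W"
        by (rule psubset_card_mono[OF less.prems]; use x v in blast)+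
      then have "decomposable ((\<lambda>v. ?N v \<inter> (W - {x})) ` ?U)"
        "decomposable ((\<lambda>w. ?N w \<inter> (W - ?N v)) ` ?U)"
        using less.hyps less.prems by blast+
      then have "decomposable {f \<in> ?H. x \<notin> f}"
        "decomposable ((\<lambda>f. f - (?N v \<inter> W)) ` {f \<in> ?H. x \<notin> f})"
        by (simp only: del del', simp only: link)
      moreover have "?N v \<inter> W \<in> ?H" "x \<in> ?N v \<inter> W" using v x by auto
      moreover have "\<And>f. f \<in> ?H \<Longrightarrow> x \<in> f \<Longrightarrow> ?N v \<inter> W \<subseteq> f" using smallest by blast
      ultimately show ?thesis by (rule decomposable.free_vertex[rotated 3])
    qed
  qed
qed

text \<open>In a bipartite graph, a minimal dominating set \<open>S\<close> is no larger than a largest independent set: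
  keep the elements of \<open>S\<close> that have no neighbour in \<open>S\<close> or belong to the first colour class, and
  replace each remaining one by a vertex that only it dominates.\<close>

lemma independent_set_of_minimal_transversal:
  fixes E :: "'v::finite \<Rightarrow> 'v \<Rightarrow> bool"
    and colour :: "'v \<Rightarrow> bool"
  assumes "simple_graph E" and colour: "\<And>u v. E u v \<Longrightarrow> colour u \<noteq> colour v"
    and S: "minimal_transversal (range (closed_neighborhood E)) S"
  shows "\<exists>I. independent_set E I \<and> card I = card S"
proof -
  have sym: "E v u" if "E u v" for u v using assms(1) that by (auto simp: simple_graph_def)
  have "\<forall>s. \<exists>p. s \<in> S \<longrightarrow> closed_neighborhood E p \<inter> S = {s}"
    using S unfolding minimal_transversal_def by blast
  then obtain p where p: "\<And>s. s \<in> S \<Longrightarrow> closed_neighborhood E (p s) \<inter> S = {s}" by metis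
  define q where "q s = (if colour s \<or> (\<forall>t\<in>S. \<not> E s t) then s else p s)" for s
  have kept: "q s = s" if "colour s \<or> (\<forall>t\<in>S. \<not> E s t)" for s
    using that by (auto simp: q_def)
  have moved: "q s \<notin> S" "colour (q s)" "\<And>t. t \<in> S \<Longrightarrow> E (q s) t \<longleftrightarrow> t = s"
    if s: "s \<in> S" and not_kept: "\<not> (colour s \<or> (\<forall>t\<in>S. \<not> E s t))" for s
  proof -
    obtain t where t: "t \<in> S" "E s t" using not_kept by blast
    have "p s \<noteq> s"
      using p[OF s] t colour[OF t(2)] by (auto simp: closed_neighborhood_def)
    have "t = s" if "t \<in> closed_neighborhood E (p s)" "t \<in> S" for t
      using that p[OF s] by blast
    then have "p s \<notin> S" and only: "E (p s) t \<Longrightarrow> t \<in> S \<Longrightarrow> t = s" for t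
      using \<open>p s \<noteq> s\<close> by (simp_all add: closed_neighborhood_def) metis
    have "s \<in> closed_neighborhood E (p s)" using p[OF s] by blast
    then have "E (p s) s" using \<open>p s \<noteq> s\<close> by (simp add: closed_neighborhood_def)
    have "\<And>t. t \<in> S \<Longrightarrow> E (p s) t \<longleftrightarrow> t = s" using only \<open>E (p s) s\<close> by blast
    moreover note \<open>p s \<notin> S\<close>
    moreover have "q s = p s" using not_kept by (auto simp: q_def)
    moreover have "colour (p s)" using colour[OF \<open>E (p s) s\<close>] not_kept by blast
    ultimately show "q s \<notin> S" "colour (q s)" "\<And>t. t \<in> S \<Longrightarrow> E (q s) t \<longleftrightarrow> t = s" by simp_all
  qed
  let ?K = "\<lambda>s. colour s \<or> (\<forall>t\<in>S. \<not> E s t)"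
  have inj: "inj_on q S"
  proof (rule inj_onI)
    fix s t assume st: "s \<in> S" "t \<in> S" "q s = q t"
    show "s = t"
    proof (cases "?K s")
      case True
      then have "q t \<in> S" using kept st by metis
      then have "?K t" using moved(1) st(2) by blast
      then show ?thesis using kept True st(3) by metis
    next
      case False
      then have "q t \<notin> S" using moved(1) st by metis
      then have "\<not> ?K t" using kept st(2) by metis
      then show ?thesis using moved(3)[OF st(1) False] moved(3)[OF st(2)] st by metis
    qed
  qed
  have "card (q ` S) = card S" using inj by (rule card_image)
  moreover have "independent_set E (q ` S)"
    unfolding independent_set_def
  proof (intro ballI notI)
    fix a b assume "a \<in> q ` S" "b \<in> q ` S" "E a b"
    then obtain s t where st: "s \<in> S" "t \<in> S" "E (q s) (q t)" by auto
    consider "?K s" "?K t" | "?K s" "\<not> ?K t" | "\<not> ?K s" "?K t" | "\<not> ?K s" "\<not> ?K t" by blast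
    then show False
    proof cases
      case 1
      then have "E s t" "E t s" using st kept sym by metis+
      then show False using 1 st colour by blast
    next
      case 2
      then have "E (q t) s" using st kept sym by metis
      then have "s = t" using moved(3)[OF st(2) 2(2) st(1)] by blast
      then show False using 2 by blast
    next
      case 3
      then have "E (q s) t" using st kept by metis
      then have "t = s" using moved(3)[OF st(1) 3(1) st(2)] by blast
      then show False using 3 by blast
    next
      case 4
      then show False using moved(2) st colour by metis
    qed
  qed
  ultimately show ?thesis by blast
qed

text \<open>A largest independent set is a minimal dominating set, that is, a minimal transversal of the
  closed neighborhoods.\<close>

lemma maximum_independent_set_minimal_transversal:
  fixes E :: "'v::finite \<Rightarrow> 'v \<Rightarrow> bool"
  assumes "simple_graph E" and S: "independent_set E S"
    and max: "\<And>I. independent_set E I \<Longrightarrow> card I \<le> card S"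
  shows "minimal_transversal (range (closed_neighborhood E)) S"
proof -
  have sym: "E v u" if "E u v" for u v using assms(1) that by (auto simp: simple_graph_def)
  have "closed_neighborhood E v \<inter> S \<noteq> {}" for v
  proof
    assume *: "closed_neighborhood E v \<inter> S = {}"
    then have "\<not> E v u" "\<not> E u v" if "u \<in> S" for u
      using that sym by (auto simp: closed_neighborhood_def)
    moreover have "\<not> E v v" using assms(1) by (simp add: simple_graph_def)
    ultimately have "independent_set E (insert v S)" using S by (simp add: independent_set_def)
    from max[OF this] * show False by (auto simp: closed_neighborhood_def)
  qed
  moreover have "closed_neighborhood E s \<inter> S = {s}" if "s \<in> S" for s
    using that S by (auto simp: independent_set_def closed_neighborhood_def)
  ultimately show ?thesis unfolding minimal_transversal_def by blast
qed

section \<open>Ideals and homogeneous components\<close>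

lemma ring_module: "Modules.module ((*) :: 'a::comm_ring_1 \<Rightarrow> 'a \<Rightarrow> 'a)"
  by unfold_locales (simp_all add: algebra_simps)

text \<open>The closure properties of an ideal; \<^const>\<open>ideal_of\<close> yields the least set that has them
  and contains the generators.\<close>

definition is_ideal :: "'a::comm_ring_1 set \<Rightarrow> bool" where
  "is_ideal I \<longleftrightarrow> 0 \<in> I \<and> (\<forall>a\<in>I. \<forall>b\<in>I. a + b \<in> I) \<and> (\<forall>a. \<forall>b\<in>I. a * b \<in> I)"

lemma is_ideal_zero: "is_ideal I \<Longrightarrow> 0 \<in> I"
  and is_ideal_add: "is_ideal I \<Longrightarrow> a \<in> I \<Longrightarrow> b \<in> I \<Longrightarrow> a + b \<in> I"
  and is_ideal_mult: "is_ideal I \<Longrightarrow> b \<in> I \<Longrightarrow> a * b \<in> I"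
  by (simp_all add: is_ideal_def)

lemma is_ideal_mult_right: "is_ideal I \<Longrightarrow> b \<in> I \<Longrightarrow> b * a \<in> I"
  using is_ideal_mult[of I b a] by (simp add: mult.commute)

lemma is_ideal_uminus: "is_ideal I \<Longrightarrow> b \<in> I \<Longrightarrow> - b \<in> I"
  using is_ideal_mult[of I b "- 1"] by simp

lemma is_ideal_diff: "is_ideal I \<Longrightarrow> a \<in> I \<Longrightarrow> b \<in> I \<Longrightarrow> a - b \<in> I"
  using is_ideal_add[of I a "- b"] is_ideal_uminus[of I b] by simp

lemma is_ideal_sum: "is_ideal I \<Longrightarrow> (\<And>i. i \<in> A \<Longrightarrow> f i \<in> I) \<Longrightarrow> sum f A \<in> I"
  by (induction A rule: infinite_finite_induct) (auto simp: is_ideal_zero is_ideal_add)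

lemma is_ideal_ideal_of: "is_ideal (ideal_of S)"
  by (simp add: is_ideal_def ideal_of_def Modules.module.span_zero[OF ring_module] Modules.module.span_add[OF ring_module]
      Modules.module.span_scale[OF ring_module])

lemma is_ideal_irrelevant_ideal: "is_ideal irrelevant_ideal"
  by (simp add: irrelevant_ideal_def is_ideal_ideal_of)

lemma ideal_of_minimal: "S \<subseteq> I \<Longrightarrow> is_ideal I \<Longrightarrow> ideal_of S \<subseteq> I"
  unfolding ideal_of_def
  by (rule Modules.module.span_minimal[OF ring_module]) (simp_all add: is_ideal_def Modules.module.subspace_def[OF ring_module])

lemma ideal_of_base: "s \<in> S \<Longrightarrow> s \<in> ideal_of S"
  by (simp add: ideal_of_def Modules.module.span_base[OF ring_module])

lemma in_ideal_of_insert: "p \<in> ideal_of (insert a S) \<longleftrightarrow> (\<exists>b. p - b * a \<in> ideal_of S)"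
  unfolding ideal_of_def by (rule Modules.module.span_breakdown_eq[OF ring_module])

lemma lookup_mult_at_zero:
  fixes p q :: "('v, 'k::comm_ring_1) mpoly"
  assumes "Poly_Mapping.lookup q 0 = 0"
  shows "Poly_Mapping.lookup (p * q) 0 = 0"
proof (rule ccontr)
  assume "\<not> ?thesis"
  then have "0 \<in> Poly_Mapping.keys (p * q)" by (simp add: in_keys_iff)
  then obtain a b where ab: "0 = a + b" "b \<in> Poly_Mapping.keys q" using keys_mult[of p q] by auto
  have "Poly_Mapping.lookup b v = 0" for v
    using arg_cong[OF ab(1), of "\<lambda>m. Poly_Mapping.lookup m v"] by (simp add: lookup_add)
  then have "b = 0" by (intro poly_mapping_eqI) simp
  then show False using ab(2) assms by (simp add: in_keys_iff)
qed

lemma one_notin_irrelevant_ideal: "(1 :: ('v, 'k::comm_ring_1) mpoly) \<notin> irrelevant_ideal"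
proof -
  let ?M = "{p :: ('v, 'k) mpoly. Poly_Mapping.lookup p 0 = 0}"
  have "Poly_Mapping.lookup (Poly_Mapping.single v (1::nat)) v \<noteq> 0" for v :: 'v by simp
  then have "Poly_Mapping.single v (1::nat) \<noteq> 0" for v :: 'v by (metis lookup_zero)
  then have "range var \<subseteq> ?M" by (auto simp: var_def lookup_single when_def)
  moreover have "is_ideal ?M" by (simp add: is_ideal_def lookup_add lookup_mult_at_zero)
  ultimately have "irrelevant_ideal \<subseteq> ?M" unfolding irrelevant_ideal_def by (rule ideal_of_minimal)
  moreover have "(1 :: ('v, 'k) mpoly) \<notin> ?M" by simp
  ultimately show ?thesis by blast
qed

lemma monomial_degree_add: "monomial_degree (m + n) = monomial_degree m + monomial_degree n"
  unfolding monomial_degree_def by (rule setsum_keys_plus_distrib) simp_all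

lemma homogeneous_zero: "homogeneous e 0"
  and homogeneous_one: "homogeneous 0 1"
  by (simp_all add: homogeneous_def monomial_degree_def)

lemma homogeneous_add: "homogeneous e p \<Longrightarrow> homogeneous e q \<Longrightarrow> homogeneous e (p + q)"
  using keys_add[of p q] by (auto simp: homogeneous_def)

lemma homogeneous_uminus: "homogeneous e p \<Longrightarrow> homogeneous e (- p)"
  by (simp add: homogeneous_def in_keys_iff)

lemma homogeneous_sum: "(\<And>i. i \<in> A \<Longrightarrow> homogeneous e (f i)) \<Longrightarrow> homogeneous e (sum f A)"
  by (induction A rule: infinite_finite_induct) (auto simp: homogeneous_zero homogeneous_add)

lemma homogeneous_mult: "homogeneous a p \<Longrightarrow> homogeneous b q \<Longrightarrow> homogeneous (a + b) (p * q)"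
  using keys_mult[of p q] by (fastforce simp: homogeneous_def monomial_degree_add)

lemma homogeneous_var: "homogeneous 1 (var v)"
  by (simp add: homogeneous_def var_def monomial_degree_def)

text \<open>The homogeneous component of degree \<open>e\<close>, which is 0 for negative \<open>e\<close>.\<close>

definition hom_component :: "int \<Rightarrow> ('v, 'k::comm_ring_1) mpoly \<Rightarrow> ('v, 'k) mpoly" where
  "hom_component e = Poly_Mapping.mapp (\<lambda>m c. c when int (monomial_degree m) = e)"

lemma lookup_hom_component: "Poly_Mapping.lookup (hom_component e p) m =
    (Poly_Mapping.lookup p m when int (monomial_degree m) = e)"
  by (auto simp: hom_component_def lookup_mapp when_def in_keys_iff)

lemma keys_hom_component:
  "Poly_Mapping.keys (hom_component e p) = {m \<in> Poly_Mapping.keys p. int (monomial_degree m) = e}"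
  by (auto simp: in_keys_iff lookup_hom_component when_def split: if_splits)

lemma homogeneous_hom_component: "homogeneous e (hom_component e p)"
  by (simp add: homogeneous_def keys_hom_component)

lemma hom_component_homogeneous: "homogeneous e p \<Longrightarrow> hom_component e p = p"
  by (rule poly_mapping_eqI)
    (auto simp: lookup_hom_component homogeneous_def in_keys_iff when_def)

lemma hom_component_add: "hom_component e (p + q) = hom_component e p + hom_component e q"
  by (rule poly_mapping_eqI) (simp add: lookup_hom_component lookup_add when_add_distrib)

lemma hom_component_diff: "hom_component e (p - q) = hom_component e p - hom_component e q"
  by (rule poly_mapping_eqI) (simp add: lookup_hom_component lookup_minus when_diff_distrib)

lemma hom_component_zero: "hom_component e 0 = 0"
  by (rule poly_mapping_eqI) (simp add: lookup_hom_component)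

lemma hom_component_sum: "hom_component e (sum f A) = (\<Sum>i\<in>A. hom_component e (f i))"
  by (induction A rule: infinite_finite_induct) (simp_all add: hom_component_zero hom_component_add)

lemma hom_component_mult:
  assumes q: "homogeneous a q"
  shows "hom_component e (q * p) = q * hom_component (e - a) p"
proof -
  let ?r = "p - hom_component (e - a) p"
  have r: "int (monomial_degree m) \<noteq> e - a" if "m \<in> Poly_Mapping.keys ?r" for m
    using that by (auto simp: in_keys_iff lookup_minus lookup_hom_component when_def)
  have "int (monomial_degree m) \<noteq> e" if m: "m \<in> Poly_Mapping.keys (q * ?r)" for m
  proof -
    obtain b c where "m = b + c" "b \<in> Poly_Mapping.keys q" "c \<in> Poly_Mapping.keys ?r"
      using m keys_mult[of q ?r] by blast
    then show ?thesis using q r[of c] by (auto simp: homogeneous_def monomial_degree_add)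
  qed
  then have "hom_component e (q * ?r) = 0"
    by (intro poly_mapping_eqI) (auto simp: lookup_hom_component in_keys_iff when_def)
  moreover have "hom_component e (q * hom_component (e - a) p) = q * hom_component (e - a) p"
    using homogeneous_mult[OF q homogeneous_hom_component[of "e - a" p]]
    by (simp add: hom_component_homogeneous)
  moreover have "q * p = q * hom_component (e - a) p + q * ?r" by (simp add: algebra_simps)
  ultimately show ?thesis by (metis add.right_neutral hom_component_add)
qed

section \<open>Edge ideals of hypergraphs\<close>

text \<open>The squarefree monomial of a set of vertices, the ideal generated by the monomials of a family of
  such sets, and the exponent vector of such a monomial. Edges may have any cardinality, and the
  empty edge has monomial 1.\<close>

definition edge_monomial :: "'v::finite set \<Rightarrow> ('v, 'k::comm_ring_1) mpoly" where
  "edge_monomial e = (\<Prod>y\<in>e. var y)"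

definition edge_ideal :: "'v::finite set set \<Rightarrow> ('v, 'k::comm_ring_1) mpoly set" where
  "edge_ideal H = ideal_of (edge_monomial ` H)"

lemma is_ideal_edge_ideal: "is_ideal (edge_ideal H)"
  by (simp add: edge_ideal_def is_ideal_ideal_of)

definition edge_exponent :: "'v::finite set \<Rightarrow> ('v \<Rightarrow>\<^sub>0 nat)" where
  "edge_exponent e = (\<Sum>y\<in>e. Poly_Mapping.single y 1)"

lemma lookup_edge_exponent: "Poly_Mapping.lookup (edge_exponent e) v = (if v \<in> e then 1 else 0)"
  by (simp add: edge_exponent_def lookup_sum lookup_single when_def sum.delta)

lemma edge_monomial_eq_single: "edge_monomial e = Poly_Mapping.single (edge_exponent e) 1"
  unfolding edge_monomial_def edge_exponent_def
  by (induction e rule: infinite_finite_induct) (simp_all add: var_def mult_single)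

lemma homogeneous_edge_monomial: "homogeneous (int (monomial_degree (edge_exponent e))) (edge_monomial e)"
  by (simp add: edge_monomial_eq_single homogeneous_def)

lemma keys_single_mult:
  fixes p :: "('v, 'k::comm_ring_1) mpoly"
  shows "Poly_Mapping.keys (Poly_Mapping.single a 1 * p) = (+) a ` Poly_Mapping.keys p"
proof -
  have lookup: "Poly_Mapping.lookup (Poly_Mapping.single a 1 * p) (a + m) = Poly_Mapping.lookup p m" for m
    by (simp add: lookup_mult lookup_single Sum_any.delta when_mult)
  then show ?thesis
    using keys_mult[of "Poly_Mapping.single a (1::'k)" p] by (force simp: in_keys_iff split: if_splits)
qed

lemma single_sum_keys: "p = (\<Sum>m\<in>Poly_Mapping.keys p. Poly_Mapping.single m (Poly_Mapping.lookup p m))"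
  by (rule poly_mapping_eqI)
    (auto simp: lookup_sum lookup_single when_def sum.delta in_keys_iff)

text \<open>A squarefree monomial ideal consists of the polynomials all of whose monomials are divisible
  by a generator.\<close>

lemma in_edge_ideal_iff:
  fixes p :: "('v::finite, 'k::comm_ring_1) mpoly"
  shows "p \<in> edge_ideal H \<longleftrightarrow> (\<forall>m\<in>Poly_Mapping.keys p. \<exists>e\<in>H. e \<subseteq> Poly_Mapping.keys m)"
proof
  let ?M = "{p :: ('v, 'k) mpoly. \<forall>m\<in>Poly_Mapping.keys p. \<exists>e\<in>H. e \<subseteq> Poly_Mapping.keys m}"
  have "edge_monomial ` H \<subseteq> ?M"
    by (auto simp: edge_monomial_eq_single in_keys_iff lookup_edge_exponent)
  moreover have "is_ideal ?M"
    unfolding is_ideal_def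
  proof (intro conjI ballI allI)
    fix a b assume "a \<in> ?M" "b \<in> ?M"
    then show "a + b \<in> ?M" using keys_add[of a b] by auto
  next
    fix a b assume b: "b \<in> ?M"
    have "\<exists>e\<in>H. e \<subseteq> Poly_Mapping.keys m" if m: "m \<in> Poly_Mapping.keys (a * b)" for m
    proof -
      obtain k l where kl: "m = k + l" "l \<in> Poly_Mapping.keys b"
        using m keys_mult[of a b] by blast
      then obtain e where "e \<in> H" "e \<subseteq> Poly_Mapping.keys l" using b by auto
      moreover have "Poly_Mapping.keys l \<subseteq> Poly_Mapping.keys m"
        unfolding kl(1) by (auto simp: in_keys_iff lookup_add)
      ultimately show ?thesis by (meson order_trans)
    qed
    then show "a * b \<in> ?M" by blast
  qed simp
  ultimately have "edge_ideal H \<subseteq> ?M" unfolding edge_ideal_def by (rule ideal_of_minimal)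
  then show "\<forall>m\<in>Poly_Mapping.keys p. \<exists>e\<in>H. e \<subseteq> Poly_Mapping.keys m" if "p \<in> edge_ideal H"
    using that by blast
next
  assume p: "\<forall>m\<in>Poly_Mapping.keys p. \<exists>e\<in>H. e \<subseteq> Poly_Mapping.keys m"
  have "Poly_Mapping.single m c \<in> (edge_ideal H :: ('v, 'k) mpoly set)"
    if "e \<in> H" "e \<subseteq> Poly_Mapping.keys m" for e m and c :: 'k
  proof -
    have "m = (m - edge_exponent e) + edge_exponent e"
    proof (rule poly_mapping_eqI)
      fix v
      have "Poly_Mapping.lookup (edge_exponent e) v \<le> Poly_Mapping.lookup m v"
        using that(2) by (auto simp: lookup_edge_exponent in_keys_iff Suc_le_eq)
      then show "Poly_Mapping.lookup m v = Poly_Mapping.lookup ((m - edge_exponent e) + edge_exponent e) v"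
        by (simp add: lookup_add lookup_minus)
    qed
    then have "Poly_Mapping.single m c = Poly_Mapping.single (m - edge_exponent e) c * edge_monomial e"
      by (simp add: edge_monomial_eq_single mult_single)
    moreover have "edge_monomial e \<in> (edge_ideal H :: ('v, 'k) mpoly set)"
      unfolding edge_ideal_def using that(1) by (intro ideal_of_base) simp
    ultimately show ?thesis using is_ideal_mult[OF is_ideal_edge_ideal] by simp
  qed
  then have "(\<Sum>m\<in>Poly_Mapping.keys p. Poly_Mapping.single m (Poly_Mapping.lookup p m)) \<in> edge_ideal H"
    using p by (intro is_ideal_sum[OF is_ideal_edge_ideal]) blast
  then show "p \<in> edge_ideal H" using single_sum_keys[of p] by simp
qed

lemma hom_component_edge_ideal: "p \<in> edge_ideal H \<Longrightarrow> hom_component e p \<in> edge_ideal H"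
  by (simp add: in_edge_ideal_iff keys_hom_component)

lemma edge_ideal_empty: "edge_ideal {} = {0}"
  by (auto simp: in_edge_ideal_iff)

lemma edge_ideal_empty_edge: "{} \<in> H \<Longrightarrow> edge_ideal H = UNIV"
  by (auto simp: in_edge_ideal_iff)

lemma keys_edge_exponent_add:
  "Poly_Mapping.keys (edge_exponent e + m) = e \<union> Poly_Mapping.keys m"
  by (auto simp: in_keys_iff lookup_add lookup_edge_exponent split: if_splits)

text \<open>The colon ideal by the monomial of \<open>e\<close> arises by deleting the vertices of \<open>e\<close> from all
  edges.\<close>

lemma edge_monomial_mult_in_edge_ideal_iff:
  "edge_monomial e * p \<in> edge_ideal H \<longleftrightarrow> p \<in> edge_ideal ((\<lambda>f. f - e) ` H)"
  by (auto simp: in_edge_ideal_iff edge_monomial_eq_single keys_single_mult keys_edge_exponent_add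
      Diff_subset_conv)

lemma var_mult_in_edge_ideal_iff:
  assumes "\<And>f. f \<in> H \<Longrightarrow> x \<notin> f"
  shows "var x * p \<in> edge_ideal H \<longleftrightarrow> p \<in> edge_ideal H"
proof -
  have "(\<lambda>f. f - {x}) ` H = H" using assms by force
  then show ?thesis using edge_monomial_mult_in_edge_ideal_iff[of "{x}" p H] by (simp add: edge_monomial_def)
qed

text \<open>Only the smallest edge \<open>e\<close> through \<open>x\<close> contributes to the generators, so the ideal is generated
  by the monomial of \<open>e\<close> together with the edges that avoid \<open>x\<close>.\<close>

lemma in_edge_ideal_free_vertex:
  assumes "e \<in> H" "x \<in> e" "\<And>f. f \<in> H \<Longrightarrow> x \<in> f \<Longrightarrow> e \<subseteq> f"
  shows "p \<in> edge_ideal H \<longleftrightarrow> (\<exists>b. p - b * edge_monomial e \<in> edge_ideal {f \<in> H. x \<notin> f})"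
proof -
  have "p \<in> edge_ideal H \<longleftrightarrow> p \<in> edge_ideal (insert e {f \<in> H. x \<notin> f})"
    unfolding in_edge_ideal_iff using assms by (intro ball_cong refl) (metis (no_types, lifting)
      insert_iff mem_Collect_eq order_trans)
  then show ?thesis by (simp add: edge_ideal_def in_ideal_of_insert)
qed

lemma var_in_irrelevant_ideal: "var x \<in> irrelevant_ideal"
  by (simp add: irrelevant_ideal_def ideal_of_base)

section \<open>Matrices of homogeneous polynomials\<close>

lemma mat_mult_entry:
  fixes A B :: "'a::comm_ring_1 mat"
  assumes "A \<in> carrier_mat a b" "B \<in> carrier_mat b n" "k < a" "j < n"
  shows "(A * B) $$ (k, j) = (\<Sum>i<b. A $$ (k, i) * B $$ (i, j))"
  using assms by (auto simp: scalar_prod_def lessThan_atLeast0 intro!: sum.cong)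

lemma mat_mult_vec_entry:
  fixes A :: "'a::comm_ring_1 mat"
  assumes "A \<in> carrier_mat a b" "v \<in> carrier_vec b" "k < a"
  shows "(A *\<^sub>v v) $ k = (\<Sum>i<b. A $$ (k, i) * v $ i)"
  using assms by (auto simp: scalar_prod_def lessThan_atLeast0 intro!: sum.cong)

lemma smult_mat_mult_vec:
  fixes A :: "'a::comm_ring_1 mat"
  assumes "A \<in> carrier_mat a b" "v \<in> carrier_vec b"
  shows "(x \<cdot>\<^sub>m A) *\<^sub>v v = x \<cdot>\<^sub>v (A *\<^sub>v v)"
  using assms by (intro eq_vecI) (simp_all add: mat_mult_vec_entry[of _ a b] sum_distrib_left mult.assoc)

lemma mat_mult_smult_vec:
  fixes A :: "'a::comm_ring_1 mat"
  assumes "A \<in> carrier_mat a b" "v \<in> carrier_vec b"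
  shows "A *\<^sub>v (x \<cdot>\<^sub>v v) = x \<cdot>\<^sub>v (A *\<^sub>v v)"
  using assms
  by (intro eq_vecI) (simp_all add: mat_mult_vec_entry[of _ a b] sum_distrib_left mult.left_commute)

lemma mat_mult_uminus_vec:
  fixes A :: "'a::comm_ring_1 mat"
  assumes "A \<in> carrier_mat a b" "v \<in> carrier_vec b"
  shows "A *\<^sub>v (- v) = - (A *\<^sub>v v)"
  using assms by (intro eq_vecI) (simp_all add: mat_mult_vec_entry[of _ a b] sum_negf)

lemma mat_mult_unit_vec:
  fixes A :: "'a::comm_ring_1 mat"
  assumes "A \<in> carrier_mat a b" "j < b"
  shows "A *\<^sub>v unit_vec b j = col A j"
  using assms by (intro eq_vecI) (auto simp: scalar_prod_right_unit[of _ b])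

text \<open>All entries of the matrix lie in \<open>I\<close>, that is, the matrix vanishes modulo \<open>I\<close>.\<close>

definition entries_in :: "'a set \<Rightarrow> 'a mat \<Rightarrow> bool" where
  "entries_in I M \<longleftrightarrow> (\<forall>k<dim_row M. \<forall>j<dim_col M. M $$ (k, j) \<in> I)"

lemma entries_in_mult_left:
  assumes "is_ideal I" "entries_in I M" "A \<in> carrier_mat a b" "M \<in> carrier_mat b n"
  shows "entries_in I (A * M)"
  using assms unfolding entries_in_def
  by (auto simp: mat_mult_entry[OF assms(3,4)] simp del: index_mult_mat(1)
      intro!: is_ideal_sum is_ideal_mult)

lemma entries_in_mult_right:
  assumes "is_ideal I" "entries_in I M" "M \<in> carrier_mat a b" "A \<in> carrier_mat b n"
  shows "entries_in I (M * A)"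
  using assms unfolding entries_in_def
  by (auto simp: mat_mult_entry[OF assms(3,4)] simp del: index_mult_mat(1)
      intro!: is_ideal_sum is_ideal_mult_right)

lemma entries_in_mult_vec:
  assumes "is_ideal I" "entries_in I M" "M \<in> carrier_mat a b" "v \<in> carrier_vec b" "k < a"
  shows "(M *\<^sub>v v) $ k \<in> I"
  using assms unfolding entries_in_def mat_mult_vec_entry[OF assms(3-5)]
  by (auto intro!: is_ideal_sum is_ideal_mult_right)

lemma entries_in_add:
  assumes "is_ideal I" "entries_in I M" "entries_in I N" "M \<in> carrier_mat a b" "N \<in> carrier_mat a b"
  shows "entries_in I (M + N)"
  using assms by (auto simp: entries_in_def is_ideal_add)

lemma entries_in_minus:
  assumes "is_ideal I" "entries_in I M" "entries_in I N" "M \<in> carrier_mat a b" "N \<in> carrier_mat a b"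
  shows "entries_in I (M - N)"
  using assms by (auto simp: entries_in_def is_ideal_diff)

text \<open>The matrix is a map of degree 0 between graded free modules whose basis elements have the
  degrees \<open>c j\<close> (source) and \<open>r k\<close> (target).\<close>

definition homogeneous_mat ::
  "(nat \<Rightarrow> int) \<Rightarrow> (nat \<Rightarrow> int) \<Rightarrow> ('v, 'k::comm_ring_1) mpoly mat \<Rightarrow> bool" where
  "homogeneous_mat r c M \<longleftrightarrow>
    (\<forall>k<dim_row M. \<forall>j<dim_col M. homogeneous (c j - r k) (M $$ (k, j)))"

lemma homogeneous_mat_mult:
  assumes "homogeneous_mat r s A" "homogeneous_mat s c B"
    and AB: "A \<in> carrier_mat a b" "B \<in> carrier_mat b n"
  shows "homogeneous_mat r c (A * B)"
proof -
  have "homogeneous (c j - r k) (A $$ (k, i) * B $$ (i, j))" if "k < a" "i < b" "j < n" for k i j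
    using homogeneous_mult[of "s i - r k" "A $$ (k, i)" "c j - s i" "B $$ (i, j)"] assms that
    by (auto simp: homogeneous_mat_def)
  then show ?thesis
    using AB by (auto simp: homogeneous_mat_def mat_mult_entry[OF AB] simp del: index_mult_mat(1)
        intro!: homogeneous_sum)
qed

lemma homogeneous_mat_smult:
  assumes "homogeneous_mat r c A" "homogeneous e p"
  shows "homogeneous_mat r (\<lambda>j. c j + e) (p \<cdot>\<^sub>m A)"
  using assms homogeneous_mult[OF assms(2)] unfolding homogeneous_mat_def
  by (fastforce simp: algebra_simps)

lemma homogeneous_mat_shift:
  "homogeneous_mat r c A \<Longrightarrow> homogeneous_mat (\<lambda>k. r k + e) (\<lambda>j. c j + e) A"
  by (simp add: homogeneous_mat_def)

text \<open>The part of a matrix that has degree 0 for the given twists of source and target.\<close>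

definition hom_part ::
  "(nat \<Rightarrow> int) \<Rightarrow> (nat \<Rightarrow> int) \<Rightarrow> ('v, 'k::comm_ring_1) mpoly mat \<Rightarrow> ('v, 'k) mpoly mat" where
  "hom_part r c M = mat (dim_row M) (dim_col M) (\<lambda>(k, j). hom_component (c j - r k) (M $$ (k, j)))"

lemma hom_part_carrier: "M \<in> carrier_mat a b \<Longrightarrow> hom_part r c M \<in> carrier_mat a b"
  by (auto simp: hom_part_def)

lemma homogeneous_mat_hom_part: "homogeneous_mat r c (hom_part r c M)"
  by (simp add: homogeneous_mat_def hom_part_def homogeneous_hom_component)

lemma hom_part_homogeneous: "homogeneous_mat r c M \<Longrightarrow> hom_part r c M = M"
  by (rule eq_matI) (simp_all add: homogeneous_mat_def hom_part_def hom_component_homogeneous)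

lemma hom_part_minus:
  assumes "M \<in> carrier_mat a b" "N \<in> carrier_mat a b"
  shows "hom_part r c (M - N) = hom_part r c M - hom_part r c N"
  using assms by (intro eq_matI) (auto simp: hom_part_def hom_component_diff)

lemma hom_part_mult:
  assumes "homogeneous_mat r s A" and AX: "A \<in> carrier_mat a b" "X \<in> carrier_mat b n"
  shows "hom_part r c (A * X) = A * hom_part s c X"
proof (rule eq_matI)
  fix k j assume "k < dim_row (A * hom_part s c X)" "j < dim_col (A * hom_part s c X)"
  then have kj: "k < a" "j < n" using AX hom_part_carrier[OF AX(2), of s c] by auto
  have "hom_part r c (A * X) $$ (k, j) = (\<Sum>i<b. hom_component (c j - r k) (A $$ (k, i) * X $$ (i, j)))"
    using kj AX by (simp add: hom_part_def mat_mult_entry[OF AX] hom_component_sum del: index_mult_mat(1))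
  also have "\<dots> = (\<Sum>i<b. A $$ (k, i) * hom_component (c j - s i) (X $$ (i, j)))"
  proof (rule sum.cong[OF refl])
    fix i assume "i \<in> {..<b}"
    then have "homogeneous (s i - r k) (A $$ (k, i))" using assms kj by (auto simp: homogeneous_mat_def)
    from hom_component_mult[OF this, of "c j - r k" "X $$ (i, j)"]
    show "hom_component (c j - r k) (A $$ (k, i) * X $$ (i, j)) =
        A $$ (k, i) * hom_component (c j - s i) (X $$ (i, j))" by simp
  qed
  also have "\<dots> = (A * hom_part s c X) $$ (k, j)"
    unfolding mat_mult_entry[OF AX(1) hom_part_carrier[OF AX(2)] kj]
    using kj AX by (simp add: hom_part_def)
  finally show "hom_part r c (A * X) $$ (k, j) = (A * hom_part s c X) $$ (k, j)" .
qed (simp_all add: hom_part_def)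

lemma factor_through_mat:
  fixes A M :: "'a::comm_ring_1 mat"
  assumes A: "A \<in> carrier_mat a b" and M: "M \<in> carrier_mat a n"
    and cols: "\<And>j. j < n \<Longrightarrow> col M j \<in> (\<lambda>y. A *\<^sub>v y) ` carrier_vec b"
  shows "\<exists>X\<in>carrier_mat b n. A * X = M"
proof -
  have "\<forall>j. \<exists>y. j < n \<longrightarrow> y \<in> carrier_vec b \<and> A *\<^sub>v y = col M j"
  proof
    fix j
    show "\<exists>y. j < n \<longrightarrow> y \<in> carrier_vec b \<and> A *\<^sub>v y = col M j"
    proof (cases "j < n")
      case True
      from cols[OF this] obtain y where "y \<in> carrier_vec b" "col M j = A *\<^sub>v y" by (rule imageE)
      then show ?thesis by metis
    qed simp
  qed
  then obtain f where f: "\<And>j. j < n \<Longrightarrow> f j \<in> carrier_vec b" "\<And>j. j < n \<Longrightarrow> A *\<^sub>v f j = col M j"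
    by metis
  let ?X = "mat b n (\<lambda>(i, j). f j $ i)"
  have "A * ?X = M"
  proof (rule mat_col_eqI)
    fix j assume "j < dim_col M"
    then have j: "j < n" using M by simp
    have "col ?X j = f j" using j f(1)[OF j] by (intro eq_vecI) auto
    then show "col (A * ?X) j = col M j" using col_mult2[OF A _ j, of ?X] f(2)[OF j] by simp
  qed (use A M in auto)
  then show ?thesis by (intro bexI[of _ ?X]) auto
qed

text \<open>Taking the part of degree 0 commutes with a homogeneous factor, so a solution of a homogeneous
  matrix equation can be replaced by a homogeneous one.\<close>

lemma factor_through_homogeneous_mat:
  assumes "homogeneous_mat r s A" "homogeneous_mat r c M"
    and A: "A \<in> carrier_mat a b" and X: "X \<in> carrier_mat b n" and "A * X = M"
  shows "\<exists>Y\<in>carrier_mat b n. A * Y = M \<and> homogeneous_mat s c Y"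
  using hom_part_mult[OF assms(1) A X, of c] assms(5) hom_part_homogeneous[OF assms(2)]
    homogeneous_mat_hom_part hom_part_carrier[OF X] by (intro bexI[of _ "hom_part s c X"]) auto

section \<open>Graded free resolutions\<close>

text \<open>A graded free resolution of \<open>R/I\<close> for a homogeneous ideal \<open>I\<close>; homogeneity is expressed as
  closure of \<open>I\<close> under taking homogeneous components.\<close>

locale graded_resolution =
  fixes I :: "('v, 'k::comm_ring_1) mpoly set" and \<beta> d \<phi>
  assumes resolution: "graded_free_resolution I \<beta> d \<phi>"
    and ideal: "is_ideal I"
    and hom_closed: "\<And>e p. p \<in> I \<Longrightarrow> hom_component e p \<in> I"
begin

lemma carrier_0: "\<phi> 0 \<in> carrier_mat 1 (\<beta> 0)"
  and carrier_Suc: "\<phi> (Suc i) \<in> carrier_mat (\<beta> i) (\<beta> (Suc i))"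
  and surjective: "\<exists>x\<in>carrier_vec (\<beta> 0). p - (\<phi> 0 *\<^sub>v x) $ 0 \<in> I"
  and exact_0: "{x \<in> carrier_vec (\<beta> 0). (\<phi> 0 *\<^sub>v x) $ 0 \<in> I} =
       (\<lambda>y. \<phi> 1 *\<^sub>v y) ` carrier_vec (\<beta> 1)"
  and exact_Suc: "{x \<in> carrier_vec (\<beta> (Suc i)). \<phi> (Suc i) *\<^sub>v x = 0\<^sub>v (\<beta> i)} =
       (\<lambda>y. \<phi> (Suc (Suc i)) *\<^sub>v y) ` carrier_vec (\<beta> (Suc (Suc i)))"
  using resolution by (simp_all add: graded_free_resolution_def)

lemma carrier_1: "\<phi> 1 \<in> carrier_mat (\<beta> 0) (\<beta> 1)"
  using carrier_Suc[of 0] by simp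

lemma homogeneous_0: "homogeneous_mat (\<lambda>_. 0) (d 0) (\<phi> 0)"
  and homogeneous_Suc: "homogeneous_mat (d i) (d (Suc i)) (\<phi> (Suc i))"
proof -
  have "\<forall>j<\<beta> 0. homogeneous (d 0 j) (\<phi> 0 $$ (0, j))"
    using resolution by (simp add: graded_free_resolution_def)
  then show "homogeneous_mat (\<lambda>_. 0) (d 0) (\<phi> 0)" using carrier_0 by (simp add: homogeneous_mat_def)
  have "\<forall>k<\<beta> i. \<forall>j<\<beta> (Suc i). homogeneous (d (Suc i) j - d i k) (\<phi> (Suc i) $$ (k, j))"
    using resolution by (simp add: graded_free_resolution_def)
  then show "homogeneous_mat (d i) (d (Suc i)) (\<phi> (Suc i))"
    using carrier_Suc[of i] by (simp add: homogeneous_mat_def)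
qed

lemma cycle_0: "y \<in> carrier_vec (\<beta> 1) \<Longrightarrow> (\<phi> 0 *\<^sub>v (\<phi> 1 *\<^sub>v y)) $ 0 \<in> I"
  using exact_0 by blast

lemma cycle_Suc: "y \<in> carrier_vec (\<beta> (Suc (Suc i))) \<Longrightarrow>
    \<phi> (Suc i) *\<^sub>v (\<phi> (Suc (Suc i)) *\<^sub>v y) = 0\<^sub>v (\<beta> i)"
  using exact_Suc[of i] by blast

lemma complex_0: "entries_in I (\<phi> 0 * \<phi> 1)"
proof -
  have "(\<phi> 0 * \<phi> 1) $$ (0, j) \<in> I" if j: "j < \<beta> 1" for j
  proof -
    have "(\<phi> 0 * \<phi> 1) $$ (0, j) = (\<phi> 0 *\<^sub>v (\<phi> 1 *\<^sub>v unit_vec (\<beta> 1) j)) $ 0"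
      using j carrier_0 carrier_1 mat_mult_unit_vec[OF carrier_1 j] by simp
    then show ?thesis using cycle_0[of "unit_vec (\<beta> 1) j"] by simp
  qed
  then show ?thesis using carrier_0 carrier_1 by (auto simp: entries_in_def)
qed

lemma complex_Suc: "\<phi> (Suc i) * \<phi> (Suc (Suc i)) = 0\<^sub>m (\<beta> i) (\<beta> (Suc (Suc i)))"
proof (rule mat_col_eqI)
  fix j assume "j < dim_col (0\<^sub>m (\<beta> i) (\<beta> (Suc (Suc i))))"
  then have j: "j < \<beta> (Suc (Suc i))" by simp
  have "col (\<phi> (Suc (Suc i))) j = \<phi> (Suc (Suc i)) *\<^sub>v unit_vec (\<beta> (Suc (Suc i))) j"
    using mat_mult_unit_vec[OF carrier_Suc j] by simp
  then show "col (\<phi> (Suc i) * \<phi> (Suc (Suc i))) j = col (0\<^sub>m (\<beta> i) (\<beta> (Suc (Suc i)))) j"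
    using col_mult2[OF carrier_Suc carrier_Suc j] cycle_Suc[of "unit_vec (\<beta> (Suc (Suc i))) j"] j
    by simp
qed (use carrier_Suc[of i] carrier_Suc[of "Suc i"] in auto)

lemma lift_0:
  assumes M: "M \<in> carrier_mat (\<beta> 0) n" and "entries_in I (\<phi> 0 * M)"
  shows "\<exists>X\<in>carrier_mat (\<beta> 1) n. \<phi> 1 * X = M"
proof (rule factor_through_mat[OF carrier_1 M])
  fix j assume j: "j < n"
  have "(\<phi> 0 *\<^sub>v col M j) $ 0 = (\<phi> 0 * M) $$ (0, j)"
    using M carrier_0 j by simp
  then have "(\<phi> 0 *\<^sub>v col M j) $ 0 \<in> I"
    using assms carrier_0 j by (auto simp: entries_in_def)
  then show "col M j \<in> (\<lambda>y. \<phi> 1 *\<^sub>v y) ` carrier_vec (\<beta> 1)"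
    using exact_0 M j by auto
qed

lemma lift_Suc:
  assumes M: "M \<in> carrier_mat (\<beta> (Suc i)) n" and "\<phi> (Suc i) * M = 0\<^sub>m (\<beta> i) n"
  shows "\<exists>X\<in>carrier_mat (\<beta> (Suc (Suc i))) n. \<phi> (Suc (Suc i)) * X = M"
proof (rule factor_through_mat[OF carrier_Suc M])
  fix j assume j: "j < n"
  have "\<phi> (Suc i) *\<^sub>v col M j = 0\<^sub>v (\<beta> i)"
    using col_mult2[OF carrier_Suc[of i] M j] assms(2) j by simp
  then show "col M j \<in> (\<lambda>y. \<phi> (Suc (Suc i)) *\<^sub>v y) ` carrier_vec (\<beta> (Suc (Suc i)))"
    using exact_Suc[of i] M j by auto
qed

text \<open>A homogeneous row of elements of \<open>R/I\<close>, viewed as a map of degree 0 from a free module, lifts along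
  the augmentation to a map of degree 0. Exactness provides some lift, and the part of degree 0 of
  it is a lift as well.\<close>

lemma lift_augmentation:
  assumes t: "t \<in> carrier_mat 1 n" and "homogeneous_mat (\<lambda>_. 0) c t"
  shows "\<exists>X\<in>carrier_mat (\<beta> 0) n. homogeneous_mat (d 0) c X \<and> entries_in I (t - \<phi> 0 * X)"
proof -
  obtain f where f: "\<And>p. f p \<in> carrier_vec (\<beta> 0)" "\<And>p. p - (\<phi> 0 *\<^sub>v f p) $ 0 \<in> I"
    using surjective by metis
  define X where "X = mat (\<beta> 0) n (\<lambda>(i, j). f (t $$ (0, j)) $ i)"
  have X: "X \<in> carrier_mat (\<beta> 0) n" by (simp add: X_def)
  have "col X j = f (t $$ (0, j))" if "j < n" for j
    using that f(1)[of "t $$ (0, j)"] by (intro eq_vecI) (auto simp: X_def)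
  then have "entries_in I (t - \<phi> 0 * X)"
    using f(2) t carrier_0 X by (auto simp: entries_in_def)
  then have "entries_in I (hom_part (\<lambda>_. 0) c (t - \<phi> 0 * X))"
    by (auto simp: entries_in_def hom_part_def hom_closed)
  moreover have "hom_part (\<lambda>_. 0) c (t - \<phi> 0 * X) = t - \<phi> 0 * hom_part (d 0) c X"
    using hom_part_minus[OF t mult_carrier_mat[OF carrier_0 X]] hom_part_homogeneous[OF assms(2)]
      hom_part_mult[OF homogeneous_0 carrier_0 X] by simp
  ultimately show ?thesis
    using homogeneous_mat_hom_part hom_part_carrier[OF X] by (intro bexI[of _ "hom_part (d 0) c X"]) auto
qed

end

text \<open>Multiplication by \<open>m\<close> is a well-defined map from \<open>R/J\<close> to \<open>R/I\<close> if \<open>m J\<close> is contained in \<open>I\<close>. It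
  lifts to a homogeneous chain map between the resolutions.\<close>

lemma (in graded_resolution) comparison:
  assumes "graded_resolution J \<gamma> c \<theta>"
    and m: "homogeneous e m" "\<And>p. p \<in> J \<Longrightarrow> m * p \<in> I"
  shows "\<exists>\<psi>. (\<forall>i. \<psi> i \<in> carrier_mat (\<beta> i) (\<gamma> i)) \<and>
    (\<forall>i. homogeneous_mat (d i) (\<lambda>j. c i j + e) (\<psi> i)) \<and>
    entries_in I (m \<cdot>\<^sub>m \<theta> 0 - \<phi> 0 * \<psi> 0) \<and>
    (\<forall>i. \<phi> (Suc i) * \<psi> (Suc i) = \<psi> i * \<theta> (Suc i))"
proof -
  interpret G: graded_resolution J \<gamma> c \<theta> by fact
  let ?hom = "\<lambda>i X. homogeneous_mat (d i) (\<lambda>j. c i j + e) X"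
  \<comment> \<open>The lift is built degree by degree; the invariant \<open>P\<close> provides for the next step.\<close>
  define P where "P i X \<longleftrightarrow> X \<in> carrier_mat (\<beta> i) (\<gamma> i) \<and> ?hom i X \<and>
    (i = 0 \<longrightarrow> entries_in I (m \<cdot>\<^sub>m \<theta> 0 - \<phi> 0 * X)) \<and>
    (\<exists>Y\<in>carrier_mat (\<beta> (Suc i)) (\<gamma> (Suc i)). \<phi> (Suc i) * Y = X * \<theta> (Suc i) \<and> ?hom (Suc i) Y)"
    for i X
  define Q where "Q i X Y \<longleftrightarrow> \<phi> (Suc i) * Y = X * \<theta> (Suc i)" for i and X Y :: "('v, 'k) mpoly mat"
  have hom_step: "homogeneous_mat (d i) (\<lambda>j. c (Suc i) j + e) (X * \<theta> (Suc i))"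
    if "?hom i X" "X \<in> carrier_mat (\<beta> i) (\<gamma> i)" for i X
    using homogeneous_mat_mult[OF that(1) homogeneous_mat_shift[OF G.homogeneous_Suc] that(2) G.carrier_Suc] .
  have "\<exists>\<psi>. \<forall>i. P i (\<psi> i) \<and> Q i (\<psi> i) (\<psi> (Suc i))"
  proof (rule dependent_nat_choice)
    have "homogeneous_mat (\<lambda>_. 0) (\<lambda>j. c 0 j + e) (m \<cdot>\<^sub>m \<theta> 0)"
      by (rule homogeneous_mat_smult[OF G.homogeneous_0 m(1)])
    then obtain X where X: "X \<in> carrier_mat (\<beta> 0) (\<gamma> 0)" "?hom 0 X"
      and aug: "entries_in I (m \<cdot>\<^sub>m \<theta> 0 - \<phi> 0 * X)"
      using lift_augmentation[of "m \<cdot>\<^sub>m \<theta> 0" "\<gamma> 0"] G.carrier_0 by auto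
    let ?N = "m \<cdot>\<^sub>m \<theta> 0 - \<phi> 0 * X"
    have N: "?N \<in> carrier_mat 1 (\<gamma> 0)" "m \<cdot>\<^sub>m \<theta> 0 \<in> carrier_mat 1 (\<gamma> 0)"
      using G.carrier_0 carrier_0 X by (auto intro: minus_carrier_mat mult_carrier_mat)
    have "\<phi> 0 * X = m \<cdot>\<^sub>m \<theta> 0 - ?N"
      using carrier_0 G.carrier_0 X by (intro eq_matI) auto
    then have "\<phi> 0 * (X * \<theta> 1) = m \<cdot>\<^sub>m (\<theta> 0 * \<theta> 1) - ?N * \<theta> 1"
      using assoc_mult_mat[OF carrier_0 X(1) G.carrier_1]
        minus_mult_distrib_mat[OF N(2,1) G.carrier_1] mult_smult_assoc_mat[OF G.carrier_0 G.carrier_1]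
      by metis
    moreover have "entries_in I (m \<cdot>\<^sub>m (\<theta> 0 * \<theta> 1))"
      using G.complex_0 m(2) by (auto simp: entries_in_def)
    moreover have "entries_in I (?N * \<theta> 1)"
      using entries_in_mult_right[OF ideal aug N(1) G.carrier_1] .
    ultimately have "entries_in I (\<phi> 0 * (X * \<theta> 1))"
      using entries_in_minus[OF ideal, of "m \<cdot>\<^sub>m (\<theta> 0 * \<theta> 1)" "?N * \<theta> 1" 1 "\<gamma> 1"]
        G.carrier_0 G.carrier_1 N by (metis mult_carrier_mat smult_carrier_mat)
    then obtain Y where "Y \<in> carrier_mat (\<beta> 1) (\<gamma> 1)" "\<phi> 1 * Y = X * \<theta> 1"
      using lift_0[of "X * \<theta> 1" "\<gamma> 1"] X G.carrier_1 mult_carrier_mat by blast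
    then show "\<exists>X. P 0 X"
      using X aug factor_through_homogeneous_mat[OF homogeneous_Suc hom_step[OF X(2,1)] carrier_Suc]
      unfolding P_def by auto
  next
    fix X i assume "P i X"
    then obtain Y where X: "X \<in> carrier_mat (\<beta> i) (\<gamma> i)"
      and Y: "Y \<in> carrier_mat (\<beta> (Suc i)) (\<gamma> (Suc i))" "\<phi> (Suc i) * Y = X * \<theta> (Suc i)" "?hom (Suc i) Y"
      unfolding P_def by blast
    have "\<phi> (Suc i) * (Y * \<theta> (Suc (Suc i))) = X * (\<theta> (Suc i) * \<theta> (Suc (Suc i)))"
      using assoc_mult_mat[OF carrier_Suc Y(1) G.carrier_Suc] Y(2)
        assoc_mult_mat[OF X G.carrier_Suc G.carrier_Suc] by simp
    also have "\<dots> = 0\<^sub>m (\<beta> i) (\<gamma> (Suc (Suc i)))"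
      using X by (simp add: G.complex_Suc)
    finally obtain Z where "Z \<in> carrier_mat (\<beta> (Suc (Suc i))) (\<gamma> (Suc (Suc i)))"
      "\<phi> (Suc (Suc i)) * Z = Y * \<theta> (Suc (Suc i))"
      using lift_Suc[of "Y * \<theta> (Suc (Suc i))" i] mult_carrier_mat[OF Y(1) G.carrier_Suc] by blast
    then show "\<exists>Y. P (Suc i) Y \<and> Q i X Y"
      using Y factor_through_homogeneous_mat[OF homogeneous_Suc hom_step[OF Y(3,1)] carrier_Suc]
      unfolding P_def Q_def by (intro exI[of _ Y]) auto
  qed
  then obtain \<psi> where "\<forall>i. P i (\<psi> i) \<and> Q i (\<psi> i) (\<psi> (Suc i))" ..
  then show ?thesis unfolding P_def Q_def by (intro exI[of _ \<psi>]) blast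
qed

lemma mat_diff_add_cancel:
  fixes A B :: "'a::ring mat"
  assumes "A \<in> carrier_mat a b" "B \<in> carrier_mat a b"
  shows "A - B + B = A"
  using assms by (intro eq_matI) auto

section \<open>Uniqueness of the length of a minimal resolution\<close>

text \<open>Minimality means that all differentials vanish modulo the irrelevant ideal.\<close>

locale minimal_resolution = graded_resolution +
  assumes minimal: "entries_in irrelevant_ideal (\<phi> (Suc i))"

lemma minimal_resolution_iff:
  "minimal_resolution I \<beta> d \<phi> \<longleftrightarrow> minimal_graded_free_resolution I \<beta> d \<phi> \<and> is_ideal I \<and>
    (\<forall>e p. p \<in> I \<longrightarrow> hom_component e p \<in> I)"
proof
  assume "minimal_resolution I \<beta> d \<phi>"
  then interpret minimal_resolution I \<beta> d \<phi> .
  have "\<phi> (Suc i) $$ (k, j) \<in> irrelevant_ideal" if "k < \<beta> i" "j < \<beta> (Suc i)" for i k j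
    using minimal[of i] carrier_Suc[of i] that by (auto simp: entries_in_def)
  then show "minimal_graded_free_resolution I \<beta> d \<phi> \<and> is_ideal I \<and>
      (\<forall>e p. p \<in> I \<longrightarrow> hom_component e p \<in> I)"
    by (simp add: minimal_graded_free_resolution_def resolution ideal hom_closed)
next
  assume *: "minimal_graded_free_resolution I \<beta> d \<phi> \<and> is_ideal I \<and>
    (\<forall>e p. p \<in> I \<longrightarrow> hom_component e p \<in> I)"
  then interpret graded_resolution I \<beta> d \<phi>
    by unfold_locales (auto simp: minimal_graded_free_resolution_def)
  have "entries_in irrelevant_ideal (\<phi> (Suc i))" for i
  proof -
    have "\<forall>k<\<beta> i. \<forall>j<\<beta> (Suc i). \<phi> (Suc i) $$ (k, j) \<in> irrelevant_ideal"
      using * by (simp add: minimal_graded_free_resolution_def)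
    then show ?thesis using carrier_Suc[of i] by (simp add: entries_in_def)
  qed
  then show "minimal_resolution I \<beta> d \<phi>" by unfold_locales
qed

text \<open>A chain endomorphism that induces zero on \<open>R/I\<close> is null-homotopic, hence zero modulo the
  irrelevant ideal if the resolution is minimal.\<close>

lemma (in minimal_resolution) null_chain_map_entries:
  assumes C: "\<And>i. C i \<in> carrier_mat (\<beta> i) (\<beta> i)"
    and C_0: "entries_in I (\<phi> 0 * C 0)"
    and C_Suc: "\<And>i. \<phi> (Suc i) * C (Suc i) = C i * \<phi> (Suc i)"
  shows "entries_in irrelevant_ideal (C i)"
proof -
  \<comment> \<open>A null-homotopy \<open>h\<close> satisfies \<open>C i - \<phi> (Suc i) * h i = h (i - 1) * \<phi> i\<close>; only the properties of
    this difference that carry the induction are recorded.\<close>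
  have "\<exists>h\<in>carrier_mat (\<beta> (Suc i)) (\<beta> i).
      (C i - \<phi> (Suc i) * h) * \<phi> (Suc i) = 0\<^sub>m (\<beta> i) (\<beta> (Suc i)) \<and>
      entries_in irrelevant_ideal (C i - \<phi> (Suc i) * h)" for i
  proof (induction i)
    case 0
    obtain h where h: "h \<in> carrier_mat (\<beta> 1) (\<beta> 0)" "\<phi> 1 * h = C 0"
      using lift_0[OF C C_0] by blast
    have "C 0 - C 0 = 0\<^sub>m (\<beta> 0) (\<beta> 0)" using C[of 0] by (intro eq_matI) auto
    moreover have "entries_in irrelevant_ideal (0\<^sub>m (\<beta> 0) (\<beta> 0))"
      by (simp add: entries_in_def is_ideal_zero[OF is_ideal_irrelevant_ideal])
    moreover have "0\<^sub>m (\<beta> 0) (\<beta> 0) * \<phi> 1 = 0\<^sub>m (\<beta> 0) (\<beta> 1)"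
      using carrier_1 by simp
    ultimately show ?case using h by (intro bexI[of _ h]) simp_all
  next
    case (Suc i)
    then obtain h where h: "h \<in> carrier_mat (\<beta> (Suc i)) (\<beta> i)"
      and zero: "(C i - \<phi> (Suc i) * h) * \<phi> (Suc i) = 0\<^sub>m (\<beta> i) (\<beta> (Suc i))" by blast
    note [simp] = C carrier_Suc h
    define M where "M = C (Suc i) - h * \<phi> (Suc i)"
    have h\<phi>: "h * \<phi> (Suc i) \<in> carrier_mat (\<beta> (Suc i)) (\<beta> (Suc i))"
      and \<phi>h: "\<phi> (Suc i) * h \<in> carrier_mat (\<beta> i) (\<beta> i)"
      by (rule mult_carrier_mat[of _ _ "\<beta> i"] mult_carrier_mat[of _ _ "\<beta> (Suc i)"]; simp)+
    have M: "M \<in> carrier_mat (\<beta> (Suc i)) (\<beta> (Suc i))"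
      using h\<phi> by (simp add: M_def minus_carrier_mat)
    have "\<phi> (Suc i) * M = C i * \<phi> (Suc i) - (\<phi> (Suc i) * h) * \<phi> (Suc i)"
      unfolding M_def C_Suc[symmetric] using h\<phi>
      by (subst mult_minus_distrib_mat[OF carrier_Suc C h\<phi>]) (simp add: assoc_mult_mat[OF carrier_Suc h carrier_Suc])
    also have "\<dots> = 0\<^sub>m (\<beta> i) (\<beta> (Suc i))"
      using zero minus_mult_distrib_mat[OF C \<phi>h carrier_Suc] by simp
    finally obtain g where g: "g \<in> carrier_mat (\<beta> (Suc (Suc i))) (\<beta> (Suc i))" "\<phi> (Suc (Suc i)) * g = M"
      using lift_Suc[OF M] by blast
    have "C (Suc i) - M = h * \<phi> (Suc i)"
      unfolding M_def using h\<phi> C[of "Suc i"] by (intro eq_matI) auto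
    moreover have "h * \<phi> (Suc i) * \<phi> (Suc (Suc i)) = 0\<^sub>m (\<beta> (Suc i)) (\<beta> (Suc (Suc i)))"
      using assoc_mult_mat[OF h carrier_Suc carrier_Suc] h by (simp add: complex_Suc)
    moreover have "entries_in irrelevant_ideal (h * \<phi> (Suc i))"
      by (rule entries_in_mult_left[OF is_ideal_irrelevant_ideal minimal h carrier_Suc])
    ultimately show ?case using g by (intro bexI[of _ g]) simp_all
  qed
  then obtain h where h: "h \<in> carrier_mat (\<beta> (Suc i)) (\<beta> i)"
    and "entries_in irrelevant_ideal (C i - \<phi> (Suc i) * h)" by blast
  moreover have "entries_in irrelevant_ideal (\<phi> (Suc i) * h)"
    by (rule entries_in_mult_right[OF is_ideal_irrelevant_ideal minimal carrier_Suc h])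
  moreover have \<phi>h: "\<phi> (Suc i) * h \<in> carrier_mat (\<beta> i) (\<beta> i)"
    by (rule mult_carrier_mat[OF carrier_Suc h])
  ultimately have "entries_in irrelevant_ideal ((C i - \<phi> (Suc i) * h) + \<phi> (Suc i) * h)"
    by (intro entries_in_add[OF is_ideal_irrelevant_ideal]) (auto intro: minus_carrier_mat)
  moreover have "(C i - \<phi> (Suc i) * h) + \<phi> (Suc i) * h = C i"
    by (rule mat_diff_add_cancel[OF C \<phi>h])
  ultimately show ?thesis by simp
qed

text \<open>The composites of the comparison maps between two minimal resolutions of \<open>R/I\<close> are homotopic to the
  identity, hence equal to it modulo the irrelevant ideal. So the free modules of the two are nonzero
  in the same homological degrees, which is all that the length depends on.\<close>

lemma minimal_resolution_support_subset:
  fixes I :: "('a, 'b::comm_ring_1) mpoly set"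
  assumes "minimal_resolution I \<beta> d \<phi>" "minimal_resolution I \<gamma> c \<theta>"
    and "\<beta> i \<noteq> 0"
  shows "\<gamma> i \<noteq> 0"
proof
  assume "\<gamma> i = 0"
  interpret F: minimal_resolution I \<beta> d \<phi> by fact
  interpret G: minimal_resolution I \<gamma> c \<theta> by fact
  obtain A where A: "\<And>i. A i \<in> carrier_mat (\<gamma> i) (\<beta> i)"
    and A_0: "entries_in I (1 \<cdot>\<^sub>m \<phi> 0 - \<theta> 0 * A 0)"
    and A_Suc: "\<And>i. \<theta> (Suc i) * A (Suc i) = A i * \<phi> (Suc i)"
    using G.comparison[OF F.graded_resolution_axioms homogeneous_one] by auto
  obtain B where B: "\<And>i. B i \<in> carrier_mat (\<beta> i) (\<gamma> i)"
    and B_0: "entries_in I (1 \<cdot>\<^sub>m \<theta> 0 - \<phi> 0 * B 0)"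
    and B_Suc: "\<And>i. \<phi> (Suc i) * B (Suc i) = B i * \<theta> (Suc i)"
    using F.comparison[OF G.graded_resolution_axioms homogeneous_one] by auto
  define C where "C i = B i * A i - 1\<^sub>m (\<beta> i)" for i
  have BA: "B i * A i \<in> carrier_mat (\<beta> i) (\<beta> i)" for i by (rule mult_carrier_mat[OF B A])
  have C: "C i \<in> carrier_mat (\<beta> i) (\<beta> i)" for i
    unfolding C_def by (simp add: minus_carrier_mat)
  have C_Suc: "\<phi> (Suc i) * C (Suc i) = C i * \<phi> (Suc i)" for i
  proof -
    have "\<phi> (Suc i) * (B (Suc i) * A (Suc i)) = B i * (\<theta> (Suc i) * A (Suc i))"
      using assoc_mult_mat[OF F.carrier_Suc B A] assoc_mult_mat[OF B G.carrier_Suc A] B_Suc by metis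
    also have "\<dots> = (B i * A i) * \<phi> (Suc i)"
      using assoc_mult_mat[OF B A F.carrier_Suc] A_Suc by metis
    finally show ?thesis
      unfolding C_def mult_minus_distrib_mat[OF F.carrier_Suc BA one_carrier_mat]
        minus_mult_distrib_mat[OF BA one_carrier_mat F.carrier_Suc]
      using F.carrier_Suc[of i] by simp
  qed
  have C_0: "entries_in I (\<phi> 0 * C 0)"
  proof -
    let ?M = "1 \<cdot>\<^sub>m \<phi> 0 - \<theta> 0 * A 0" and ?N = "1 \<cdot>\<^sub>m \<theta> 0 - \<phi> 0 * B 0"
    have \<theta>A: "\<theta> 0 * A 0 \<in> carrier_mat 1 (\<beta> 0)" by (rule mult_carrier_mat[OF G.carrier_0 A])
    have \<phi>B: "\<phi> 0 * B 0 \<in> carrier_mat 1 (\<gamma> 0)" by (rule mult_carrier_mat[OF F.carrier_0 B])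
    have N: "?N \<in> carrier_mat 1 (\<gamma> 0)" using \<phi>B by (rule minus_carrier_mat)
    have NA: "?N * A 0 \<in> carrier_mat 1 (\<beta> 0)" by (rule mult_carrier_mat[OF N A])
    have one: "1 \<cdot>\<^sub>m \<theta> 0 = \<theta> 0" "1 \<cdot>\<^sub>m \<phi> 0 = \<phi> 0" by (auto intro!: eq_matI)
    have C_eq: "\<phi> 0 * C 0 = \<phi> 0 * B 0 * A 0 - \<phi> 0"
      unfolding C_def mult_minus_distrib_mat[OF F.carrier_0 BA one_carrier_mat]
        assoc_mult_mat[OF F.carrier_0 B A] using F.carrier_0 by simp
    have N_eq: "?N * A 0 = \<theta> 0 * A 0 - \<phi> 0 * B 0 * A 0"
      unfolding one by (rule minus_mult_distrib_mat[OF G.carrier_0 \<phi>B A])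
    have ident: "P - Q = 0\<^sub>m 1 n - ((S - P) + (Q - S))"
      if "P \<in> carrier_mat 1 n" "Q \<in> carrier_mat 1 n" "S \<in> carrier_mat 1 n"
      for P Q S :: "('a, 'b) mpoly mat" and n
      using that by (intro eq_matI) auto
    have "\<phi> 0 * C 0 = 0\<^sub>m 1 (\<beta> 0) - (?N * A 0 + ?M)"
      unfolding C_eq N_eq one(2) by (rule ident[OF mult_carrier_mat[OF \<phi>B A] F.carrier_0 \<theta>A])
    moreover have "entries_in I (?N * A 0)" by (rule entries_in_mult_right[OF F.ideal B_0 N A])
    moreover have M: "?M \<in> carrier_mat 1 (\<beta> 0)" using \<theta>A by (rule minus_carrier_mat)
    moreover have "entries_in I (0\<^sub>m 1 (\<beta> 0))" by (simp add: entries_in_def is_ideal_zero[OF F.ideal])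
    moreover have "entries_in I (?N * A 0 + ?M)"
      by (rule entries_in_add[OF F.ideal \<open>entries_in I (?N * A 0)\<close> A_0 NA M])
    ultimately show ?thesis
      using entries_in_minus[OF F.ideal, of "0\<^sub>m 1 (\<beta> 0)" "?N * A 0 + ?M" 1 "\<beta> 0"]
        add_carrier_mat[OF M, of "?N * A 0"] by simp
  qed
  have "entries_in irrelevant_ideal (C i)"
    by (rule F.null_chain_map_entries[OF C C_0 C_Suc])
  then have "C i $$ (0, 0) \<in> irrelevant_ideal"
    using C[of i] \<open>\<beta> i \<noteq> 0\<close> by (auto simp: entries_in_def)
  \<comment> \<open>The product \<open>B i * A i\<close> factors through a module of rank 0, so \<open>C i\<close> is minus the identity.\<close>
  moreover have "C i $$ (0, 0) = - 1"
    using mat_mult_entry[OF B A, of 0 i 0] BA[of i] \<open>\<beta> i \<noteq> 0\<close> \<open>\<gamma> i = 0\<close> by (simp add: C_def del: index_mult_mat(1))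
  ultimately show False
    using is_ideal_uminus[OF is_ideal_irrelevant_ideal, of "- 1 :: ('a, 'b) mpoly"]
      one_notin_irrelevant_ideal[where 'v = 'a and 'k = 'b] by simp
qed

lemma pd_quotient_eqI:
  assumes "is_ideal I" "\<And>e p. p \<in> I \<Longrightarrow> hom_component e p \<in> I"
    and res: "minimal_graded_free_resolution I \<beta> d \<phi>"
  shows "pd_quotient I = resolution_length \<beta>"
  unfolding pd_quotient_def
proof (rule the_equality)
  show "\<exists>\<beta>' d \<phi>. minimal_graded_free_resolution I \<beta>' d \<phi> \<and> resolution_length \<beta> = resolution_length \<beta>'"
    using res by blast
next
  fix l assume "\<exists>\<beta> d \<phi>. minimal_graded_free_resolution I \<beta> d \<phi> \<and> l = resolution_length \<beta>"
  then obtain \<gamma> c \<theta> where "minimal_graded_free_resolution I \<gamma> c \<theta>" and l: "l = resolution_length \<gamma>" by blast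
  then have "minimal_resolution I \<gamma> c \<theta>" "minimal_resolution I \<beta> d \<phi>"
    using assms by (simp_all add: minimal_resolution_iff)
  then have "{i. \<gamma> i \<noteq> 0} = {i. \<beta> i \<noteq> 0}"
    using minimal_resolution_support_subset by blast
  then show "l = resolution_length \<beta>" by (simp add: l resolution_length_def)
qed

section \<open>A minimal mapping cone\<close>

lemma append_vec_zero_dim: "dim_vec w = 0 \<Longrightarrow> v @\<^sub>v w = v"
  by (rule eq_vecI) auto

lemma vec_cancel:
  fixes u v :: "'a::ring vec"
  assumes "u \<in> carrier_vec n" "v \<in> carrier_vec n"
  shows "u = u - v + v" "u = u + v + - v" "v + - v = 0\<^sub>v n"
  using assms by (auto intro!: eq_vecI)

text \<open>Suppose that \<open>I = I' + (x m)\<close>, that \<open>x\<close> is a nonzerodivisor modulo \<open>I'\<close>, and that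
  \<open>I'' = (I' : m)\<close>. Then multiplication by \<open>x m\<close> is an injection of \<open>R/I''\<close> into \<open>R/I'\<close> with cokernel
  \<open>R/I\<close>. It lifts to \<open>x\<close> times a chain map, so all entries of the lift lie in the irrelevant ideal
  when \<open>x\<close> does, and the mapping cone is a minimal resolution.\<close>

lemma minimal_mapping_cone:
  fixes I I' I'' :: "('v, 'k::comm_ring_1) mpoly set"
  assumes "minimal_resolution I' \<beta> d \<phi>" "minimal_resolution I'' \<gamma> c \<theta>"
    and m: "homogeneous e m"
    and x: "homogeneous 1 x" "x \<in> irrelevant_ideal"
    and colon: "\<And>p. m * p \<in> I' \<longleftrightarrow> p \<in> I''"
    and regular: "\<And>p. x * p \<in> I' \<Longrightarrow> p \<in> I'"
    and I: "\<And>p. p \<in> I \<longleftrightarrow> (\<exists>b. p - b * (x * m) \<in> I')"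
  shows "\<exists>\<delta> \<Phi>. minimal_graded_free_resolution I
    (\<lambda>i. \<beta> i + (case i of 0 \<Rightarrow> 0 | Suc k \<Rightarrow> \<gamma> k)) \<delta> \<Phi>"
proof -
  interpret F: minimal_resolution I' \<beta> d \<phi> by fact
  interpret G: minimal_resolution I'' \<gamma> c \<theta> by fact
  obtain \<psi> where \<psi>: "\<And>i. \<psi> i \<in> carrier_mat (\<beta> i) (\<gamma> i)"
    and \<psi>_hom: "\<And>i. homogeneous_mat (d i) (\<lambda>j. c i j + e) (\<psi> i)"
    and \<psi>_0: "entries_in I' (m \<cdot>\<^sub>m \<theta> 0 - \<phi> 0 * \<psi> 0)"
    and \<psi>_Suc: "\<And>i. \<phi> (Suc i) * \<psi> (Suc i) = \<psi> i * \<theta> (Suc i)"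
    using F.comparison[OF G.graded_resolution_axioms m] colon by blast
  define \<chi> where "\<chi> i = x \<cdot>\<^sub>m \<psi> i" for i
  have \<chi>: "\<chi> i \<in> carrier_mat (\<beta> i) (\<gamma> i)" for i using \<psi> by (simp add: \<chi>_def)
  have \<chi>_hom: "homogeneous_mat (d i) (\<lambda>j. c i j + e + 1) (\<chi> i)" for i
    unfolding \<chi>_def by (rule homogeneous_mat_smult[OF \<psi>_hom x(1)])
  have \<chi>_min: "entries_in irrelevant_ideal (\<chi> i)" for i
    using is_ideal_mult_right[OF is_ideal_irrelevant_ideal x(2)] by (simp add: entries_in_def \<chi>_def)
  have \<chi>_vec: "\<chi> i *\<^sub>v z = x \<cdot>\<^sub>v (\<psi> i *\<^sub>v z)" if "z \<in> carrier_vec (\<gamma> i)" for i z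
    unfolding \<chi>_def by (rule smult_mat_mult_vec[OF \<psi> that])
  have \<chi>_Suc: "\<phi> (Suc i) *\<^sub>v (\<chi> (Suc i) *\<^sub>v z) = \<chi> i *\<^sub>v (\<theta> (Suc i) *\<^sub>v z)"
    if z: "z \<in> carrier_vec (\<gamma> (Suc i))" for i z
  proof -
    have "\<phi> (Suc i) *\<^sub>v (\<psi> (Suc i) *\<^sub>v z) = \<psi> i *\<^sub>v (\<theta> (Suc i) *\<^sub>v z)"
      using assoc_mult_mat_vec[OF F.carrier_Suc \<psi> z] assoc_mult_mat_vec[OF \<psi> G.carrier_Suc z] \<psi>_Suc
      by metis
    then show ?thesis
      using \<chi>_vec[OF z] \<chi>_vec[OF mult_mat_vec_carrier[OF G.carrier_Suc z]]
        mat_mult_smult_vec[OF F.carrier_Suc mult_mat_vec_carrier[OF \<psi> z]] by simp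
  qed
  have \<psi>_aug: "m * (\<theta> 0 *\<^sub>v z) $ 0 - (\<phi> 0 *\<^sub>v (\<psi> 0 *\<^sub>v z)) $ 0 \<in> I'" if z: "z \<in> carrier_vec (\<gamma> 0)" for z
  proof -
    have \<theta>0: "m \<cdot>\<^sub>m \<theta> 0 \<in> carrier_mat 1 (\<gamma> 0)" using G.carrier_0 by simp
    have \<phi>\<psi>: "\<phi> 0 * \<psi> 0 \<in> carrier_mat 1 (\<gamma> 0)" by (rule mult_carrier_mat[OF F.carrier_0 \<psi>])
    have "((m \<cdot>\<^sub>m \<theta> 0 - \<phi> 0 * \<psi> 0) *\<^sub>v z) $ 0 \<in> I'"
      by (rule entries_in_mult_vec[OF F.ideal \<psi>_0 minus_carrier_mat[OF \<phi>\<psi>] z]) simp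
    moreover have "(m \<cdot>\<^sub>m \<theta> 0 - \<phi> 0 * \<psi> 0) *\<^sub>v z = m \<cdot>\<^sub>v (\<theta> 0 *\<^sub>v z) - \<phi> 0 *\<^sub>v (\<psi> 0 *\<^sub>v z)"
      unfolding minus_mult_distrib_mat_vec[OF \<theta>0 \<phi>\<psi> z] smult_mat_mult_vec[OF G.carrier_0 z]
        assoc_mult_mat_vec[OF F.carrier_0 \<psi> z] ..
    ultimately show ?thesis using F.carrier_0 G.carrier_0 by simp
  qed
  have \<chi>_0: "(\<phi> 0 *\<^sub>v (\<chi> 0 *\<^sub>v z)) $ 0 = x * (\<phi> 0 *\<^sub>v (\<psi> 0 *\<^sub>v z)) $ 0"
    if z: "z \<in> carrier_vec (\<gamma> 0)" for z
    unfolding \<chi>_vec[OF z] mat_mult_smult_vec[OF F.carrier_0 mult_mat_vec_carrier[OF \<psi> z]]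
    using F.carrier_0 by simp
  have \<chi>_aug: "(\<phi> 0 *\<^sub>v (\<chi> 0 *\<^sub>v z)) $ 0 - (\<theta> 0 *\<^sub>v z) $ 0 * (x * m) \<in> I'"
    if z: "z \<in> carrier_vec (\<gamma> 0)" for z
  proof -
    have eq: "x * p - t * (x * m) = - x * (m * t - p)" for p t by (simp add: algebra_simps)
    show ?thesis unfolding \<chi>_0[OF z] eq by (rule is_ideal_mult[OF F.ideal \<psi>_aug[OF z]])
  qed
  have \<chi>_cycle: "(\<theta> 0 *\<^sub>v z) $ 0 \<in> I''" if z: "z \<in> carrier_vec (\<gamma> 0)" and "(\<phi> 0 *\<^sub>v (\<chi> 0 *\<^sub>v z)) $ 0 \<in> I'" for z
  proof -
    have "(\<phi> 0 *\<^sub>v (\<psi> 0 *\<^sub>v z)) $ 0 \<in> I'" using that(2) unfolding \<chi>_0[OF z] by (rule regular)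
    from is_ideal_add[OF F.ideal \<psi>_aug[OF z] this] have "m * (\<theta> 0 *\<^sub>v z) $ 0 \<in> I'"
      by (simp only: diff_add_cancel)
    then show ?thesis by (simp only: colon)
  qed

  \<comment> \<open>In degree \<open>i\<close> the cone is the sum of the \<open>i\<close>-th module of the first and the \<open>(i - 1)\<close>-st module of
    the second resolution. The latter has rank \<open>s i\<close>, and \<open>D i\<close> is the differential between
    these shifted summands.\<close>
  define s where "s i = (case i of 0 \<Rightarrow> 0 | Suc k \<Rightarrow> \<gamma> k)" for i
  have s_simps [simp]: "s 0 = 0" "s (Suc i) = \<gamma> i" for i by (simp_all add: s_def)
  define D where "D i = (case i of 0 \<Rightarrow> 0\<^sub>m 0 (\<gamma> 0) | Suc k \<Rightarrow> - \<theta> (Suc k))" for i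
  have D: "D i \<in> carrier_mat (s i) (\<gamma> i)" for i
    using G.carrier_Suc by (cases i) (auto simp: D_def)
  have D_Suc: "D (Suc i) *\<^sub>v w = - (\<theta> (Suc i) *\<^sub>v w)" if "w \<in> carrier_vec (\<gamma> (Suc i))" for i w
    using that G.carrier_Suc[of i] by (simp add: D_def)
  define \<Phi> where "\<Phi> i = (case i of 0 \<Rightarrow> \<phi> 0 |
    Suc k \<Rightarrow> four_block_mat (\<phi> (Suc k)) (\<chi> k) (0\<^sub>m (s k) (\<beta> (Suc k))) (D k))" for i
  define \<delta> where "\<delta> i j = (if j < \<beta> i then d i j else (case i of 0 \<Rightarrow> 0 | Suc k \<Rightarrow> c k (j - \<beta> i) + e + 1))"
    for i j
  have \<Phi>_0: "\<Phi> 0 = \<phi> 0" by (simp add: \<Phi>_def)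
  have \<Phi>: "\<Phi> (Suc i) \<in> carrier_mat (\<beta> i + s i) (\<beta> (Suc i) + s (Suc i))" for i
    unfolding \<Phi>_def using four_block_carrier_mat[OF F.carrier_Suc D] by simp
  have \<Phi>_vec: "\<Phi> (Suc i) *\<^sub>v (u @\<^sub>v z) = (\<phi> (Suc i) *\<^sub>v u + \<chi> i *\<^sub>v z) @\<^sub>v (D i *\<^sub>v z)"
    if "u \<in> carrier_vec (\<beta> (Suc i))" "z \<in> carrier_vec (\<gamma> i)" for i u z
  proof -
    have "0\<^sub>m (s i) (\<beta> (Suc i)) *\<^sub>v u + D i *\<^sub>v z = D i *\<^sub>v z"
      using that D[of i] by (intro eq_vecI) auto
    then show ?thesis
      using four_block_mat_mult_vec[OF F.carrier_Suc \<chi> zero_carrier_mat D that] by (simp add: \<Phi>_def)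
  qed
  have split: "v \<in> carrier_vec (a + b) \<Longrightarrow> \<exists>u z. u \<in> carrier_vec a \<and> z \<in> carrier_vec b \<and> v = u @\<^sub>v z"
    for v :: "('v, 'k) mpoly vec" and a b
    using vec_first_last_append[of v a b] vec_first_carrier vec_last_carrier by metis

  have entries: "\<Phi> (Suc i) $$ (k, j) =
      (if k < \<beta> i then if j < \<beta> (Suc i) then \<phi> (Suc i) $$ (k, j) else \<chi> i $$ (k, j - \<beta> (Suc i))
       else if j < \<beta> (Suc i) then 0 else D i $$ (k - \<beta> i, j - \<beta> (Suc i)))"
    if "k < \<beta> i + s i" "j < \<beta> (Suc i) + \<gamma> i" for i k j
    using that F.carrier_Suc[of i] D[of i] by (auto simp: \<Phi>_def)

  have hom: "homogeneous (\<delta> (Suc i) j - \<delta> i k) (\<Phi> (Suc i) $$ (k, j))"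
    if kj: "k < \<beta> i + s i" "j < \<beta> (Suc i) + s (Suc i)" for i k j
  proof -
    have j: "j < \<beta> (Suc i) + \<gamma> i" using kj by simp
    have 1: "homogeneous (d (Suc i) j - d i k) (\<phi> (Suc i) $$ (k, j))" if "k < \<beta> i" "j < \<beta> (Suc i)"
      using F.homogeneous_Suc[of i] F.carrier_Suc[of i] that by (simp add: homogeneous_mat_def)
    have 2: "homogeneous (c i l + e + 1 - d i k) (\<chi> i $$ (k, l))" if "k < \<beta> i" "l < \<gamma> i" for l
      using \<chi>_hom[of i] \<chi>[of i] that by (simp add: homogeneous_mat_def)
    have 3: "homogeneous (c (Suc n) l - c n k') (D (Suc n) $$ (k', l))"
      if "k' < \<gamma> n" "l < \<gamma> (Suc n)" for n k' l
    proof -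
      have "homogeneous (c (Suc n) l - c n k') (\<theta> (Suc n) $$ (k', l))"
        using G.homogeneous_Suc[of n] G.carrier_Suc[of n] that by (simp add: homogeneous_mat_def)
      moreover have "D (Suc n) $$ (k', l) = - (\<theta> (Suc n) $$ (k', l))"
        using G.carrier_Suc[of n] that by (simp add: D_def)
      ultimately show ?thesis by (simp only: homogeneous_uminus)
    qed
    show ?thesis
    proof (cases i)
      case 0
      then show ?thesis using 1 2[of "j - \<beta> (Suc i)"] kj j entries[OF kj(1) j]
        by (auto simp: \<delta>_def homogeneous_zero)
    next
      case (Suc n)
      then show ?thesis
        using 1 2[of "j - \<beta> (Suc i)"] 3[of "k - \<beta> i" n "j - \<beta> (Suc i)"] kj j entries[OF kj(1) j]
        by (auto simp: \<delta>_def homogeneous_zero algebra_simps)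
    qed
  qed
  have min: "\<Phi> (Suc i) $$ (k, j) \<in> irrelevant_ideal"
    if kj: "k < \<beta> i + s i" "j < \<beta> (Suc i) + s (Suc i)" for i k j
  proof -
    have j: "j < \<beta> (Suc i) + \<gamma> i" using kj by simp
    have D_min: "entries_in irrelevant_ideal (D i)"
      using G.minimal by (cases i)
        (auto simp: D_def entries_in_def intro: is_ideal_uminus[OF is_ideal_irrelevant_ideal])
    show ?thesis
      unfolding entries[OF kj(1) j]
      using F.minimal[of i] F.carrier_Suc[of i] \<chi>_min[of i] \<chi>[of i] D_min D[of i] kj j
        is_ideal_zero[OF is_ideal_irrelevant_ideal] by (auto simp: entries_in_def)
  qed

  have surj: "\<exists>u\<in>carrier_vec (\<beta> 0 + s 0). p - (\<Phi> 0 *\<^sub>v u) $ 0 \<in> I" for p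
  proof -
    obtain u where "u \<in> carrier_vec (\<beta> 0)" "p - (\<phi> 0 *\<^sub>v u) $ 0 \<in> I'" using F.surjective by blast
    moreover have "q \<in> I' \<Longrightarrow> q \<in> I" for q unfolding I by (intro exI[of _ 0]) simp
    ultimately show ?thesis by (auto simp: \<Phi>_0)
  qed

  have exact_0: "{u \<in> carrier_vec (\<beta> 0 + s 0). (\<Phi> 0 *\<^sub>v u) $ 0 \<in> I} =
      (\<lambda>v. \<Phi> 1 *\<^sub>v v) ` carrier_vec (\<beta> 1 + s 1)" (is "?K = ?B")
  proof (intro equalityI subsetI)
    fix u assume "u \<in> ?K"
    then obtain b where u: "u \<in> carrier_vec (\<beta> 0)" and b: "(\<phi> 0 *\<^sub>v u) $ 0 - b * (x * m) \<in> I'"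
      by (auto simp: \<Phi>_0 I)
    obtain z where z: "z \<in> carrier_vec (\<gamma> 0)" and bz: "b - (\<theta> 0 *\<^sub>v z) $ 0 \<in> I''"
      using G.surjective by blast
    have \<chi>z: "\<chi> 0 *\<^sub>v z \<in> carrier_vec (\<beta> 0)" by (rule mult_mat_vec_carrier[OF \<chi> z])
    have "m * (b - (\<theta> 0 *\<^sub>v z) $ 0) \<in> I'" using bz by (simp add: colon)
    then have "x * (m * (b - (\<theta> 0 *\<^sub>v z) $ 0)) \<in> I'" by (rule is_ideal_mult[OF F.ideal])
    moreover have "p - q = (p - b * (x * m)) + x * (m * (b - t)) - (q - t * (x * m))" for p q t
      by (simp add: algebra_simps)
    ultimately have "(\<phi> 0 *\<^sub>v u) $ 0 - (\<phi> 0 *\<^sub>v (\<chi> 0 *\<^sub>v z)) $ 0 \<in> I'"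
      using is_ideal_diff[OF F.ideal is_ideal_add[OF F.ideal b] \<chi>_aug[OF z]] by metis
    then have "(\<phi> 0 *\<^sub>v (u - \<chi> 0 *\<^sub>v z)) $ 0 \<in> I'"
      unfolding mult_minus_distrib_mat_vec[OF F.carrier_0 u \<chi>z] using F.carrier_0 by simp
    moreover have "u - \<chi> 0 *\<^sub>v z \<in> carrier_vec (\<beta> 0)" using u \<chi>z by simp
    ultimately obtain y where y: "y \<in> carrier_vec (\<beta> 1)" "u - \<chi> 0 *\<^sub>v z = \<phi> 1 *\<^sub>v y"
      using F.exact_0 by blast
    have "u = \<phi> 1 *\<^sub>v y + \<chi> 0 *\<^sub>v z"
      unfolding y(2)[symmetric] by (rule vec_cancel(1)[OF u \<chi>z])
    also have "\<dots> = \<Phi> 1 *\<^sub>v (y @\<^sub>v z)"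
      using \<Phi>_vec[of y 0 z] y(1) z D[of 0] by (simp add: append_vec_zero_dim)
    finally show "u \<in> ?B" using y(1) z by (intro image_eqI[of _ _ "y @\<^sub>v z"]) auto
  next
    fix u assume "u \<in> ?B"
    then obtain v where "v \<in> carrier_vec (\<beta> 1 + \<gamma> 0)" "u = \<Phi> 1 *\<^sub>v v" by auto
    with split obtain y z where y: "y \<in> carrier_vec (\<beta> 1)" and z: "z \<in> carrier_vec (\<gamma> 0)"
      and "u = \<Phi> 1 *\<^sub>v (y @\<^sub>v z)" by metis
    then have u: "u = \<phi> 1 *\<^sub>v y + \<chi> 0 *\<^sub>v z"
      using \<Phi>_vec[of y 0 z] D[of 0] by (simp add: append_vec_zero_dim)
    have yz: "\<phi> 1 *\<^sub>v y \<in> carrier_vec (\<beta> 0)" "\<chi> 0 *\<^sub>v z \<in> carrier_vec (\<beta> 0)"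
      using mult_mat_vec_carrier[OF F.carrier_1 y] mult_mat_vec_carrier[OF \<chi> z] by simp_all
    have "(\<phi> 0 *\<^sub>v u) $ 0 = (\<phi> 0 *\<^sub>v (\<phi> 1 *\<^sub>v y)) $ 0 + (\<phi> 0 *\<^sub>v (\<chi> 0 *\<^sub>v z)) $ 0"
      unfolding u mult_add_distrib_mat_vec[OF F.carrier_0 yz] using F.carrier_0 by simp
    then have "(\<phi> 0 *\<^sub>v u) $ 0 - (\<theta> 0 *\<^sub>v z) $ 0 * (x * m) \<in> I'"
      using is_ideal_add[OF F.ideal F.cycle_0[OF y] \<chi>_aug[OF z]] by (simp only: add_diff_eq)
    then have "(\<phi> 0 *\<^sub>v u) $ 0 \<in> I" unfolding I by blast
    then show "u \<in> ?K" using yz by (simp add: u \<Phi>_0)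
  qed

  have exact_Suc: "{v \<in> carrier_vec (\<beta> (Suc i) + s (Suc i)). \<Phi> (Suc i) *\<^sub>v v = 0\<^sub>v (\<beta> i + s i)} =
      (\<lambda>v. \<Phi> (Suc (Suc i)) *\<^sub>v v) ` carrier_vec (\<beta> (Suc (Suc i)) + s (Suc (Suc i)))" (is "?K = ?B") for i
  proof (intro equalityI subsetI)
    fix v assume "v \<in> ?K"
    then have "v \<in> carrier_vec (\<beta> (Suc i) + \<gamma> i)" and zero: "\<Phi> (Suc i) *\<^sub>v v = 0\<^sub>v (\<beta> i + s i)" by auto
    with split obtain u z where u: "u \<in> carrier_vec (\<beta> (Suc i))" and z: "z \<in> carrier_vec (\<gamma> i)"
      and v: "v = u @\<^sub>v z" by metis
    have \<phi>u: "\<phi> (Suc i) *\<^sub>v u \<in> carrier_vec (\<beta> i)" by (rule mult_mat_vec_carrier[OF F.carrier_Suc u])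
    have \<chi>z: "\<chi> i *\<^sub>v z \<in> carrier_vec (\<beta> i)" by (rule mult_mat_vec_carrier[OF \<chi> z])
    have "0\<^sub>v (\<beta> i + s i) = 0\<^sub>v (\<beta> i) @\<^sub>v (0\<^sub>v (s i) :: ('v, 'k) mpoly vec)" by (intro eq_vecI) auto
    then have "(\<phi> (Suc i) *\<^sub>v u + \<chi> i *\<^sub>v z) @\<^sub>v (D i *\<^sub>v z) = 0\<^sub>v (\<beta> i) @\<^sub>v 0\<^sub>v (s i)"
      using zero \<Phi>_vec[OF u z] v by simp
    then have top: "\<phi> (Suc i) *\<^sub>v u + \<chi> i *\<^sub>v z = 0\<^sub>v (\<beta> i)" and bot: "D i *\<^sub>v z = 0\<^sub>v (s i)"
      using append_vec_eq[of "\<phi> (Suc i) *\<^sub>v u + \<chi> i *\<^sub>v z" "\<beta> i" "0\<^sub>v (\<beta> i)"] \<phi>u \<chi>z by simp_all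
    \<comment> \<open>The second component \<open>z\<close> of a cycle is a boundary. For \<open>i = 0\<close> this is where the regularity of
      \<open>x\<close> and the colon ideal enter.\<close>
    have "\<exists>w\<in>carrier_vec (\<gamma> (Suc i)). z = \<theta> (Suc i) *\<^sub>v w"
    proof (cases i)
      case 0
      have "(\<phi> 0 *\<^sub>v (\<phi> 1 *\<^sub>v u)) $ 0 + (\<phi> 0 *\<^sub>v (\<chi> 0 *\<^sub>v z)) $ 0 =
          (\<phi> 0 *\<^sub>v (\<phi> 1 *\<^sub>v u + \<chi> 0 *\<^sub>v z)) $ 0"
        using mult_add_distrib_mat_vec[OF F.carrier_0, of "\<phi> 1 *\<^sub>v u" "\<chi> 0 *\<^sub>v z"] \<phi>u \<chi>z F.carrier_0 0
        by simp
      also have "\<dots> = 0" using top 0 F.carrier_0 row_carrier_vec[of 0 1 "\<phi> 0" "\<beta> 0"] by simp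
      finally have "(\<phi> 0 *\<^sub>v (\<chi> 0 *\<^sub>v z)) $ 0 = - (\<phi> 0 *\<^sub>v (\<phi> 1 *\<^sub>v u)) $ 0"
        by (simp add: eq_neg_iff_add_eq_0 add.commute)
      moreover have "(\<phi> 0 *\<^sub>v (\<phi> 1 *\<^sub>v u)) $ 0 \<in> I'" using F.cycle_0 u 0 by simp
      ultimately have "(\<phi> 0 *\<^sub>v (\<chi> 0 *\<^sub>v z)) $ 0 \<in> I'" using is_ideal_uminus[OF F.ideal] by simp
      then have "(\<theta> 0 *\<^sub>v z) $ 0 \<in> I''" using \<chi>_cycle z 0 by simp
      then show ?thesis using G.exact_0 z 0 by auto
    next
      case (Suc n)
      have "\<theta> (Suc n) *\<^sub>v z = 0\<^sub>v (\<gamma> n)"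
        using bot z Suc D_Suc[of z n] G.carrier_Suc[of n]
          uminus_zero_vec_eq[OF mult_mat_vec_carrier[OF G.carrier_Suc[of n]], of z] by simp
      then show ?thesis using G.exact_Suc[of n] z Suc by auto
    qed
    then obtain w where w: "w \<in> carrier_vec (\<gamma> (Suc i))" and zw: "z = \<theta> (Suc i) *\<^sub>v w" by blast
    have \<chi>w: "\<chi> (Suc i) *\<^sub>v w \<in> carrier_vec (\<beta> (Suc i))" by (rule mult_mat_vec_carrier[OF \<chi> w])
    have "\<phi> (Suc i) *\<^sub>v (u + \<chi> (Suc i) *\<^sub>v w) = 0\<^sub>v (\<beta> i)"
      unfolding mult_add_distrib_mat_vec[OF F.carrier_Suc u \<chi>w] \<chi>_Suc[OF w] zw[symmetric] by (rule top)
    moreover have "u + \<chi> (Suc i) *\<^sub>v w \<in> carrier_vec (\<beta> (Suc i))" using u \<chi>w by simp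
    ultimately obtain y where y: "y \<in> carrier_vec (\<beta> (Suc (Suc i)))"
      and uy: "u + \<chi> (Suc i) *\<^sub>v w = \<phi> (Suc (Suc i)) *\<^sub>v y"
      using F.exact_Suc[of i] by blast
    have nw: "- w \<in> carrier_vec (\<gamma> (Suc i))" using w by simp
    note neg = mat_mult_uminus_vec[OF _ w]
    have "u = \<phi> (Suc (Suc i)) *\<^sub>v y + \<chi> (Suc i) *\<^sub>v (- w)"
      unfolding uy[symmetric] neg[OF \<chi>] by (rule vec_cancel(2)[OF u \<chi>w])
    moreover have "z = D (Suc i) *\<^sub>v (- w)"
      unfolding D_Suc[OF nw] neg[OF G.carrier_Suc] zw by simp
    ultimately have "v = \<Phi> (Suc (Suc i)) *\<^sub>v (y @\<^sub>v (- w))" using \<Phi>_vec[OF y nw] v by simp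
    then show "v \<in> ?B" using y nw by (intro image_eqI[of _ _ "y @\<^sub>v (- w)"]) auto
  next
    fix v assume "v \<in> ?B"
    then obtain v' where "v' \<in> carrier_vec (\<beta> (Suc (Suc i)) + \<gamma> (Suc i))" "v = \<Phi> (Suc (Suc i)) *\<^sub>v v'"
      by auto
    with split obtain y w where y: "y \<in> carrier_vec (\<beta> (Suc (Suc i)))" and w: "w \<in> carrier_vec (\<gamma> (Suc i))"
      and "v = \<Phi> (Suc (Suc i)) *\<^sub>v (y @\<^sub>v w)" by metis
    then have v: "v = (\<phi> (Suc (Suc i)) *\<^sub>v y + \<chi> (Suc i) *\<^sub>v w) @\<^sub>v (- (\<theta> (Suc i) *\<^sub>v w))"
      using \<Phi>_vec[OF y w] D_Suc[OF w] by simp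
    let ?u = "\<phi> (Suc (Suc i)) *\<^sub>v y + \<chi> (Suc i) *\<^sub>v w" and ?z = "- (\<theta> (Suc i) *\<^sub>v w)"
    have \<phi>y: "\<phi> (Suc (Suc i)) *\<^sub>v y \<in> carrier_vec (\<beta> (Suc i))" by (rule mult_mat_vec_carrier[OF F.carrier_Suc y])
    have \<chi>w: "\<chi> (Suc i) *\<^sub>v w \<in> carrier_vec (\<beta> (Suc i))" by (rule mult_mat_vec_carrier[OF \<chi> w])
    have \<theta>w: "\<theta> (Suc i) *\<^sub>v w \<in> carrier_vec (\<gamma> i)" by (rule mult_mat_vec_carrier[OF G.carrier_Suc w])
    have u: "?u \<in> carrier_vec (\<beta> (Suc i))" and z: "?z \<in> carrier_vec (\<gamma> i)" using \<phi>y \<chi>w \<theta>w by simp_all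
    note neg = mat_mult_uminus_vec[OF _ \<theta>w]
    have \<chi>\<theta>w: "\<chi> i *\<^sub>v (\<theta> (Suc i) *\<^sub>v w) \<in> carrier_vec (\<beta> i)" by (rule mult_mat_vec_carrier[OF \<chi> \<theta>w])
    have "\<phi> (Suc i) *\<^sub>v ?u + \<chi> i *\<^sub>v ?z = 0\<^sub>v (\<beta> i)"
      unfolding mult_add_distrib_mat_vec[OF F.carrier_Suc \<phi>y \<chi>w] F.cycle_Suc[OF y] \<chi>_Suc[OF w] neg[OF \<chi>]
      using vec_cancel(3)[OF \<chi>\<theta>w \<chi>\<theta>w] \<chi>\<theta>w by simp
    moreover have "D i *\<^sub>v ?z = 0\<^sub>v (s i)"
    proof (cases i)
      case 0
      then show ?thesis using D[of 0] by (intro eq_vecI) auto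
    next
      case (Suc n)
      have "\<theta> (Suc n) *\<^sub>v (\<theta> (Suc i) *\<^sub>v w) = 0\<^sub>v (\<gamma> n)" using G.cycle_Suc[of w n] w Suc by simp
      then show ?thesis unfolding neg[OF D] using D_Suc[of "\<theta> (Suc i) *\<^sub>v w" n] \<theta>w Suc by simp
    qed
    moreover have "0\<^sub>v (\<beta> i) @\<^sub>v 0\<^sub>v (s i) = (0\<^sub>v (\<beta> i + s i) :: ('v, 'k) mpoly vec)" by (intro eq_vecI) auto
    ultimately have "\<Phi> (Suc i) *\<^sub>v v = 0\<^sub>v (\<beta> i + s i)" unfolding v \<Phi>_vec[OF u z] by simp
    moreover have "v \<in> carrier_vec (\<beta> (Suc i) + \<gamma> i)" unfolding v using u z by (rule append_carrier_vec)
    ultimately show "v \<in> ?K" by simp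
  qed

  have aug_hom: "homogeneous (\<delta> 0 j) (\<Phi> 0 $$ (0, j))" if "j < \<beta> 0 + s 0" for j
    using F.homogeneous_0 F.carrier_0 that by (simp add: homogeneous_mat_def \<delta>_def \<Phi>_0)
  have "minimal_graded_free_resolution I (\<lambda>i. \<beta> i + s i) \<delta> \<Phi>"
    unfolding minimal_graded_free_resolution_def graded_free_resolution_def
  proof (intro conjI allI impI)
    show "\<Phi> 0 \<in> carrier_mat 1 (\<beta> 0 + s 0)" using F.carrier_0 by (simp add: \<Phi>_0)
  qed (fact \<Phi> aug_hom hom min surj exact_0 exact_Suc)+
  then show ?thesis unfolding s_def by blast
qed

section \<open>Edge ideals of decomposable hypergraphs\<close>

lemma minimal_resolution_of_zero_ideal:
  "\<exists>d \<phi>. minimal_graded_free_resolution {0 :: ('v, 'k::comm_ring_1) mpoly}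
    (\<lambda>i. if i = 0 then 1 else 0) d \<phi>"
proof -
  let ?\<beta> = "\<lambda>i :: nat. if i = 0 then 1 else 0 :: nat"
  let ?\<phi> = "\<lambda>i. if i = 0 then 1\<^sub>m 1 else 0\<^sub>m (?\<beta> (i - 1)) (?\<beta> i) :: ('v, 'k) mpoly mat"
  have vec_1: "x = 0\<^sub>v 1" if "x \<in> carrier_vec 1" "x $ 0 = 0" for x :: "('v, 'k) mpoly vec"
    using that by (intro eq_vecI) auto
  have vec_0: "carrier_vec 0 = {0\<^sub>v 0 :: ('v, 'k) mpoly vec}" by (auto intro!: eq_vecI)
  have mat_0: "0\<^sub>m a 0 *\<^sub>v vNil = (0\<^sub>v a :: ('v, 'k) mpoly vec)" for a
    by (intro eq_vecI) auto
  have "minimal_graded_free_resolution {0} ?\<beta> (\<lambda>_ _. 0) ?\<phi>"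
    unfolding minimal_graded_free_resolution_def graded_free_resolution_def
  proof (intro conjI allI impI)
    fix p :: "('v, 'k) mpoly"
    show "\<exists>x\<in>carrier_vec (?\<beta> 0). p - (?\<phi> 0 *\<^sub>v x) $ 0 \<in> {0}"
      by (intro bexI[of _ "vec 1 (\<lambda>_. p)"]) auto
  next
    have "{x \<in> carrier_vec 1. (1\<^sub>m 1 *\<^sub>v x) $ 0 \<in> {0 :: ('v, 'k) mpoly}} = {0\<^sub>v 1}"
      using vec_1 by auto
    then show "{x \<in> carrier_vec (?\<beta> 0). (?\<phi> 0 *\<^sub>v x) $ 0 \<in> {0}} = (*\<^sub>v) (?\<phi> 1) ` carrier_vec (?\<beta> 1)"
      by (simp add: vec_0 mat_0)
  next
    fix i
    show "{x \<in> carrier_vec (?\<beta> (Suc i)). ?\<phi> (Suc i) *\<^sub>v x = 0\<^sub>v (?\<beta> i)} =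
        (*\<^sub>v) (?\<phi> (Suc (Suc i))) ` carrier_vec (?\<beta> (Suc (Suc i)))"
      by (cases i) (auto simp: vec_0 mat_0)
  qed (auto simp: homogeneous_one)
  then show ?thesis by blast
qed

lemma minimal_resolution_of_unit_ideal:
  "\<exists>d \<phi>. minimal_graded_free_resolution (UNIV :: ('v, 'k::comm_ring_1) mpoly set) (\<lambda>_. 0) d \<phi>"
proof -
  have "carrier_vec 0 = {0\<^sub>v 0 :: ('v, 'k) mpoly vec}" by (auto intro!: eq_vecI)
  moreover have "0\<^sub>m 0 0 *\<^sub>v 0\<^sub>v 0 = (0\<^sub>v 0 :: ('v, 'k) mpoly vec)" by (intro eq_vecI) auto
  ultimately have "minimal_graded_free_resolution (UNIV :: ('v, 'k) mpoly set) (\<lambda>_. 0) (\<lambda>_ _. 0)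
      (\<lambda>i. if i = 0 then 0\<^sub>m 1 0 else 0\<^sub>m 0 0)"
    unfolding minimal_graded_free_resolution_def graded_free_resolution_def by auto
  then show ?thesis by blast
qed

text \<open>The last two conjuncts say that the length of the resolution is the largest cardinality of a
  minimal transversal, and that the resolution is zero iff there is no minimal transversal, as
  happens when some edge is empty. Both invariants obey the same recursion at a free vertex \<open>x\<close>: a
  minimal transversal of the edges that avoid \<open>x\<close> becomes one of all edges, possibly after adding \<open>x\<close>, and
  one that avoids \<open>e\<close> is the same as a minimal transversal of those edges with \<open>e\<close> deleted.\<close>

lemma decomposable_minimal_resolution:
  fixes H :: "'v::finite set set"
  assumes "decomposable H"
  shows "\<exists>\<beta> d \<phi>. minimal_graded_free_resolution (edge_ideal H :: ('v, 'k::comm_ring_1) mpoly set) \<beta> d \<phi> \<and>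
    (\<forall>n. \<beta> n \<noteq> 0 \<longrightarrow> (\<exists>S. minimal_transversal H S \<and> n \<le> card S)) \<and>
    (\<forall>S. minimal_transversal H S \<longrightarrow> (\<exists>n\<ge>card S. \<beta> n \<noteq> 0))"
  using assms
proof (induction H rule: decomposable.induct)
  case no_edges
  have "minimal_transversal {} S \<longleftrightarrow> S = {}" for S :: "'v set"
    by (auto simp: minimal_transversal_def)
  moreover obtain d \<phi> where "minimal_graded_free_resolution (edge_ideal {} :: ('v, 'k) mpoly set)
      (\<lambda>i. if i = 0 then 1 else 0) d \<phi>"
    unfolding edge_ideal_empty using minimal_resolution_of_zero_ideal by blast
  ultimately show ?case by (intro exI[of _ "\<lambda>i. if i = 0 then 1 else 0"] exI[of _ d] exI[of _ \<phi>]) auto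
next
  case (empty_edge H)
  then have "\<not> minimal_transversal H S" for S using minimal_transversal_hits by blast
  moreover obtain d \<phi> where "minimal_graded_free_resolution (edge_ideal H :: ('v, 'k) mpoly set) (\<lambda>_. 0) d \<phi>"
    unfolding edge_ideal_empty_edge[OF empty_edge] using minimal_resolution_of_unit_ideal by blast
  ultimately show ?case by (intro exI[of _ "\<lambda>_. 0"] exI[of _ d] exI[of _ \<phi>]) auto
next
  case (free_vertex e H x)
  note free = free_vertex.hyps(1-3)
  let ?H' = "{f \<in> H. x \<notin> f}"
  let ?H'' = "(\<lambda>f. f - e) ` ?H'"
  obtain \<beta> d \<phi> where res: "minimal_graded_free_resolution (edge_ideal ?H' :: ('v, 'k) mpoly set) \<beta> d \<phi>"
    and \<beta>: "\<And>n. \<beta> n \<noteq> 0 \<Longrightarrow> \<exists>S. minimal_transversal ?H' S \<and> n \<le> card S"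
      "\<And>S. minimal_transversal ?H' S \<Longrightarrow> \<exists>n\<ge>card S. \<beta> n \<noteq> 0"
    using free_vertex.IH(1) by blast
  obtain \<gamma> c \<theta> where res': "minimal_graded_free_resolution (edge_ideal ?H'' :: ('v, 'k) mpoly set) \<gamma> c \<theta>"
    and \<gamma>: "\<And>n. \<gamma> n \<noteq> 0 \<Longrightarrow> \<exists>S. minimal_transversal ?H'' S \<and> n \<le> card S"
      "\<And>S. minimal_transversal ?H'' S \<Longrightarrow> \<exists>n\<ge>card S. \<gamma> n \<noteq> 0"
    using free_vertex.IH(2) by blast
  let ?m = "edge_monomial (e - {x}) :: ('v, 'k) mpoly"
  define \<delta> where "\<delta> i = \<beta> i + (case i of 0 \<Rightarrow> 0 | Suc k \<Rightarrow> \<gamma> k)" for i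
  have "\<exists>d \<phi>. minimal_graded_free_resolution (edge_ideal H :: ('v, 'k) mpoly set) \<delta> d \<phi>"
    unfolding \<delta>_def
  proof (rule minimal_mapping_cone)
    show "minimal_resolution (edge_ideal ?H' :: ('v, 'k) mpoly set) \<beta> d \<phi>"
      using res by (simp add: minimal_resolution_iff is_ideal_edge_ideal hom_component_edge_ideal)
    show "minimal_resolution (edge_ideal ?H'' :: ('v, 'k) mpoly set) \<gamma> c \<theta>"
      using res' by (simp add: minimal_resolution_iff is_ideal_edge_ideal hom_component_edge_ideal)
    show "homogeneous (int (monomial_degree (edge_exponent (e - {x})))) ?m"
      by (rule homogeneous_edge_monomial)
    show "homogeneous 1 (var x :: ('v, 'k) mpoly)" by (rule homogeneous_var)
    show "var x \<in> (irrelevant_ideal :: ('v, 'k) mpoly set)" by (rule var_in_irrelevant_ideal)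
  next
    fix p :: "('v, 'k) mpoly"
    have "(\<lambda>f. f - (e - {x})) ` ?H' = ?H''" by (intro image_cong) auto
    then show "?m * p \<in> edge_ideal ?H' \<longleftrightarrow> p \<in> edge_ideal ?H''"
      using edge_monomial_mult_in_edge_ideal_iff[of "e - {x}" p ?H'] by simp
    show "p \<in> edge_ideal ?H'" if "var x * p \<in> edge_ideal ?H'"
      using that var_mult_in_edge_ideal_iff[of ?H' x p] by simp
    have "var x * ?m = edge_monomial e"
      using free(2) by (simp add: edge_monomial_def prod.remove[of e x])
    then show "p \<in> edge_ideal H \<longleftrightarrow> (\<exists>b. p - b * (var x * ?m) \<in> edge_ideal ?H')"
      using in_edge_ideal_free_vertex[OF free] by simp
  qed
  moreover have "\<exists>S. minimal_transversal H S \<and> n \<le> card S" if nonzero: "\<delta> n \<noteq> 0" for n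
  proof (cases "\<beta> n = 0")
    case False
    then obtain S where S: "minimal_transversal ?H' S" "n \<le> card S" using \<beta>(1) by blast
    show ?thesis using minimal_transversal_extend_deletion[OF free S(1)]
    proof
      assume "minimal_transversal H S"
      then show ?thesis using S(2) by blast
    next
      assume "minimal_transversal H (insert x S) \<and> x \<notin> S"
      moreover from this have "n \<le> card (insert x S)" using S(2) by simp
      ultimately show ?thesis by blast
    qed
  next
    case True
    then obtain k where k: "n = Suc k" "\<gamma> k \<noteq> 0"
      using nonzero by (cases n) (auto simp: \<delta>_def)
    then obtain S where S: "minimal_transversal ?H'' S" "k \<le> card S" using \<gamma>(1) by blast
    then have "n \<le> card (insert x S)"
      using minimal_transversal_extend_link(2)[OF free(1,2) S(1)] k by simp
    then show ?thesis using minimal_transversal_extend_link(1)[OF free(1,2) S(1)] by blast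
  qed
  moreover have "\<exists>n\<ge>card S. \<delta> n \<noteq> 0" if S: "minimal_transversal H S" for S
    using minimal_transversal_restrict[OF free S]
  proof
    assume "minimal_transversal ?H' S"
    then show ?thesis using \<beta>(2)[of S] by (auto simp: \<delta>_def)
  next
    assume "\<exists>s\<in>S. minimal_transversal ?H'' (S - {s})"
    then obtain s where "s \<in> S" "minimal_transversal ?H'' (S - {s})" by blast
    then obtain n where "n \<ge> card (S - {s})" "\<gamma> n \<noteq> 0" using \<gamma>(2) by blast
    then have "Suc n \<ge> card S" "\<delta> (Suc n) \<noteq> 0"
      using \<open>s \<in> S\<close> by (simp_all add: \<delta>_def card_Diff_singleton)
    then show ?thesis by blast
  qed
  ultimately show ?case by blast
qed

section \<open>The projective dimension of closed neighborhood ideals\<close>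

lemma closed_neighborhood_ideal_eq_edge_ideal:
  "closed_neighborhood_ideal T = edge_ideal (range (closed_neighborhood T))"
  by (simp add: closed_neighborhood_ideal_def edge_ideal_def image_image
      closed_neighborhood_monomial_def[abs_def] edge_monomial_def)

theorem theorem3p14:
  fixes T :: "'v::finite \<Rightarrow> 'v \<Rightarrow> bool"
  assumes "is_tree T"
  shows "pd_quotient (closed_neighborhood_ideal T :: ('v, 'k::field) mpoly set) =
         enat (independence_number T)"
proof -
  let ?H = "range (closed_neighborhood T)"
  let ?I = "edge_ideal ?H :: ('v, 'k) mpoly set"
  have T: "simple_graph T" "\<nexists>c. is_cycle T c" using assms by (simp_all add: is_tree_def)
  obtain rank :: "'v \<Rightarrow> nat" and par and colour :: "'v \<Rightarrow> bool"
    where forest: "\<And>u v. T u v \<Longrightarrow>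
      colour u \<noteq> colour v \<and> (rank u < rank v \<and> v = par u \<or> rank v < rank u \<and> u = par v)"
    using acyclic_elimination[OF T finite_UNIV] by auto
  have "decomposable ((\<lambda>v. closed_neighborhood T v \<inter> UNIV) ` UNIV)"
  proof (rule closed_neighborhood_traces_decomposable)
    show "T v u" if "T u v" for u v using that T(1) by (simp add: simple_graph_def)
    show "rank u < rank v \<and> v = par u \<or> rank v < rank u \<and> u = par v" if "T u v" for u v
      using forest[OF that] by blast
  qed simp
  then have "decomposable ?H" by simp
  then obtain \<beta> d \<phi> where res: "minimal_graded_free_resolution ?I \<beta> d \<phi>"
    and upper: "\<And>n. \<beta> n \<noteq> 0 \<Longrightarrow> \<exists>S. minimal_transversal ?H S \<and> n \<le> card S"
    and lower: "\<And>S. minimal_transversal ?H S \<Longrightarrow> \<exists>n\<ge>card S. \<beta> n \<noteq> 0"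
    using decomposable_minimal_resolution[where 'k = 'k] by blast
  have max: "card S \<le> independence_number T" if "independent_set T S" for S
    unfolding independence_number_def using that by (intro Max_ge) auto
  have "independence_number T \<in> card ` {S. independent_set T S}"
    unfolding independence_number_def
  proof (rule Max_in)
    have "independent_set T {}" by (simp add: independent_set_def)
    then show "card ` {S. independent_set T S} \<noteq> {}" by blast
  qed simp
  then obtain S where S: "independent_set T S" "card S = independence_number T" by auto
  have "minimal_transversal ?H S"
    using maximum_independent_set_minimal_transversal[OF T(1) S(1)] max S(2) by simp
  then obtain n where n: "n \<ge> independence_number T" "\<beta> n \<noteq> 0" using lower S(2) by metis
  have bound: "n \<le> independence_number T" if nonzero: "\<beta> n \<noteq> 0" for n
  proof -
    obtain S where S: "minimal_transversal ?H S" "n \<le> card S" using upper[OF nonzero] by blast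
    obtain I where "independent_set T I" "card I = card S"
      using independent_set_of_minimal_transversal[OF T(1) _ S(1)] forest by metis
    then show ?thesis using max[of I] S(2) by simp
  qed
  have "resolution_length \<beta> = enat (independence_number T)"
    unfolding resolution_length_def
  proof (rule antisym)
    show "(SUP i\<in>{i. \<beta> i \<noteq> 0}. enat i) \<le> enat (independence_number T)"
      using bound by (intro SUP_least) simp
    have "n = independence_number T" using n bound[OF n(2)] by simp
    then show "enat (independence_number T) \<le> (SUP i\<in>{i. \<beta> i \<noteq> 0}. enat i)"
      using n(2) by (intro SUP_upper) simp
  qed
  moreover have "pd_quotient ?I = resolution_length \<beta>"
    using is_ideal_edge_ideal hom_component_edge_ideal res by (rule pd_quotient_eqI)
  ultimately show ?thesis by (simp add: closed_neighborhood_ideal_eq_edge_ideal)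
qed

end
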